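(* Let $X$ be a Banach space and $Y$ a closed subspace of $X$. If $X/Y$ is strongly regular and $Y$ has $BSCSP$, then $X$ has $BSCSP$.
   Context: Banach spaces are real and nontrivial. For a Banach space $E$, $B_E$ is the closed unit ball and $S_E$ the unit sphere. For a nonempty bounded set $C\subseteq E$, a slice of $C$ is a set $S(C,x^*,\alpha)=\{x\in C: x^*(x)>\sup x^*(C)-\alpha\}$ with $x^*\in S_{E^*}$ and $\alpha>0$. A convex combination of slices of $C$ is a set $\sum_{i=1}^n\lambda_i S_i$ (Minkowski sum), where each $S_i$ is a slice of $C$, $\lambda_i\ge 0$ and $\sum_{i=1}^n\lambda_i=1$. $E$ has the Ball Small Combination of Slice Property ($BSCSP$) if for every $\varepsilon>0$ there is a convex combination of slices of $B_E$ with diameter less than $\varepsilon$. $E$ is strongly regular if for every nonempty closed, convex, bounded subset $C$ of $E$ and every $\varepsilon>0$ there is a convex combination of slices of $C$ with diameter less than $\varepsilon$. *)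

theory Defs
  imports "HOL-Analysis.Analysis"
begin

text \<open>
  The statement concerns a Banach space \<open>X\<close>, a closed subspace \<open>Y\<close> and the quotient \<open>X/Y\<close>.
  The latter two depend on the term \<open>Y\<close> and so cannot be types; normed spaces are
  therefore represented as carrier sets with explicit operations, so that each geometric notion
  has one definition that applies to all three spaces. Values outside the carrier are irrelevant.
\<close>

record 'e nspace =
  pts :: "'e set"
  vadd :: "'e \<Rightarrow> 'e \<Rightarrow> 'e"
  vzero :: 'e
  vscale :: "real \<Rightarrow> 'e \<Rightarrow> 'e"
  vnorm :: "'e \<Rightarrow> real"

text \<open>
  Metric_space requires a symmetric, nonnegative distance on the whole type,
  hence the value 0 outside the carrier.
\<close>

definition vdist :: "'e nspace \<Rightarrow> 'e \<Rightarrow> 'e \<Rightarrow> real" where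
  "vdist E x y = (if x \<in> pts E \<and> y \<in> pts E then vnorm E (vadd E x (vscale E (-1) y)) else 0)"

locale real_normed_space =
  fixes E :: "'e nspace"
  assumes add_closed: "\<lbrakk>x \<in> pts E; y \<in> pts E\<rbrakk> \<Longrightarrow> vadd E x y \<in> pts E"
    and zero_closed: "vzero E \<in> pts E"
    and scale_closed: "x \<in> pts E \<Longrightarrow> vscale E a x \<in> pts E"
    and add_assoc: "\<lbrakk>x \<in> pts E; y \<in> pts E; z \<in> pts E\<rbrakk>
          \<Longrightarrow> vadd E (vadd E x y) z = vadd E x (vadd E y z)"
    and add_commute: "\<lbrakk>x \<in> pts E; y \<in> pts E\<rbrakk> \<Longrightarrow> vadd E x y = vadd E y x"
    and add_zero: "x \<in> pts E \<Longrightarrow> vadd E x (vzero E) = x"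
    and add_neg: "x \<in> pts E \<Longrightarrow> vadd E x (vscale E (-1) x) = vzero E"
    and scale_add_right: "\<lbrakk>x \<in> pts E; y \<in> pts E\<rbrakk>
          \<Longrightarrow> vscale E a (vadd E x y) = vadd E (vscale E a x) (vscale E a y)"
    and scale_add_left: "x \<in> pts E \<Longrightarrow> vscale E (a + b) x = vadd E (vscale E a x) (vscale E b x)"
    and scale_scale: "x \<in> pts E \<Longrightarrow> vscale E a (vscale E b x) = vscale E (a * b) x"
    and scale_one: "x \<in> pts E \<Longrightarrow> vscale E 1 x = x"
    and norm_eq_zero: "x \<in> pts E \<Longrightarrow> vnorm E x = 0 \<longleftrightarrow> x = vzero E"
    and norm_nonneg: "x \<in> pts E \<Longrightarrow> 0 \<le> vnorm E x"
    and norm_triangle: "\<lbrakk>x \<in> pts E; y \<in> pts E\<rbrakk> \<Longrightarrow> vnorm E (vadd E x y) \<le> vnorm E x + vnorm E y"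
    and norm_scale: "x \<in> pts E \<Longrightarrow> vnorm E (vscale E a x) = \<bar>a\<bar> * vnorm E x"

definition subspace_of :: "'a::real_normed_vector set \<Rightarrow> 'a nspace" where
  "subspace_of Y = \<lparr>pts = Y, vadd = (+), vzero = 0, vscale = (*\<^sub>R), vnorm = norm\<rparr>"

text \<open>
  The points of \<open>X/Y\<close> are the cosets \<open>x +o Y\<close>; \<open>A + B\<close> is the elementwise sum. Scaling adds \<open>Y\<close>
  because \<open>0\<close> must send every coset to \<open>Y\<close>. The norm of a coset is the infimum of the norms of
  its elements.
\<close>

definition quotient_by :: "'a::real_normed_vector set \<Rightarrow> 'a set nspace" where
  "quotient_by Y =
     \<lparr>pts = range (\<lambda>x. x +o Y), vadd = (+), vzero = Y,
      vscale = (\<lambda>c A. (*\<^sub>R) c ` A + Y), vnorm = (\<lambda>A. INF a\<in>A. norm a)\<rparr>"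

definition unit_ball :: "'e nspace \<Rightarrow> 'e set" where
  "unit_ball E = {x \<in> pts E. vnorm E x \<le> 1}"

definition dual :: "'e nspace \<Rightarrow> ('e \<Rightarrow> real) set" where
  "dual E = {f. (\<forall>x\<in>pts E. \<forall>y\<in>pts E. f (vadd E x y) = f x + f y) \<and>
                (\<forall>c. \<forall>x\<in>pts E. f (vscale E c x) = c * f x) \<and>
                (\<exists>K. \<forall>x\<in>pts E. \<bar>f x\<bar> \<le> K * vnorm E x)}"

definition dual_norm :: "'e nspace \<Rightarrow> ('e \<Rightarrow> real) \<Rightarrow> real" where
  "dual_norm E f = (SUP x\<in>unit_ball E. \<bar>f x\<bar>)"

definition dual_sphere :: "'e nspace \<Rightarrow> ('e \<Rightarrow> real) set" where
  "dual_sphere E = {f \<in> dual E. dual_norm E f = 1}"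

definition slice :: "'e set \<Rightarrow> ('e \<Rightarrow> real) \<Rightarrow> real \<Rightarrow> 'e set" where
  "slice C f \<alpha> = {x \<in> C. f x > (SUP z\<in>C. f z) - \<alpha>}"

definition is_slice :: "'e nspace \<Rightarrow> 'e set \<Rightarrow> 'e set \<Rightarrow> bool" where
  "is_slice E C S \<longleftrightarrow> (\<exists>f\<in>dual_sphere E. \<exists>\<alpha>>0. S = slice C f \<alpha>)"

primrec minkowski_comb ::
    "'e nspace \<Rightarrow> (nat \<Rightarrow> real) \<Rightarrow> (nat \<Rightarrow> 'e set) \<Rightarrow> nat \<Rightarrow> 'e set" where
  "minkowski_comb E l S 0 = {vzero E}"
| "minkowski_comb E l S (Suc n) =
     {vadd E u (vscale E (l n) s) | u s. u \<in> minkowski_comb E l S n \<and> s \<in> S n}"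

definition convex_comb_of_slices :: "'e nspace \<Rightarrow> 'e set \<Rightarrow> 'e set \<Rightarrow> bool" where
  "convex_comb_of_slices E C D \<longleftrightarrow>
     (\<exists>n l S. (\<forall>i<n. 0 \<le> l i \<and> is_slice E C (S i)) \<and> (\<Sum>i<n. l i) = 1 \<and>
              D = minkowski_comb E l S n)"

text \<open>The next definition is meaningful for nonempty bounded sets, the only ones it is used for.\<close>

definition vdiameter :: "'e nspace \<Rightarrow> 'e set \<Rightarrow> real" where
  "vdiameter E D = (SUP (x, y)\<in>D \<times> D. vdist E x y)"

definition BSCSP :: "'e nspace \<Rightarrow> bool" where
  "BSCSP E \<longleftrightarrow> (\<forall>\<epsilon>>0. \<exists>D. convex_comb_of_slices E (unit_ball E) D \<and> vdiameter E D < \<epsilon>)"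

definition vclosed :: "'e nspace \<Rightarrow> 'e set \<Rightarrow> bool" where
  "vclosed E C \<longleftrightarrow> closedin (Metric_space.mtopology (pts E) (vdist E)) C"

definition vbounded :: "'e nspace \<Rightarrow> 'e set \<Rightarrow> bool" where
  "vbounded E C \<longleftrightarrow> (\<exists>K. \<forall>x\<in>C. vnorm E x \<le> K)"

definition vconvex :: "'e nspace \<Rightarrow> 'e set \<Rightarrow> bool" where
  "vconvex E C \<longleftrightarrow> (\<forall>x\<in>C. \<forall>y\<in>C. \<forall>u\<ge>0. \<forall>v\<ge>0. u + v = 1 \<longrightarrow>
     vadd E (vscale E u x) (vscale E v y) \<in> C)"

definition strongly_regular :: "'e nspace \<Rightarrow> bool" where
  "strongly_regular E \<longleftrightarrow>
     (\<forall>C. C \<subseteq> pts E \<and> C \<noteq> {} \<and> vclosed E C \<and> vconvex E C \<and> vbounded E C \<longrightarrow>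
       (\<forall>\<epsilon>>0. \<exists>D. convex_comb_of_slices E C D \<and> vdiameter E D < \<epsilon>))"

section \<open>The spaces in question are normed spaces, and Metric_space applies to them\<close>

context real_normed_space
begin

lemma Metric_space_vdist: "Metric_space (pts E) (vdist E)"
proof
  fix x y
  show "0 \<le> vdist E x y"
    by (auto simp: vdist_def intro!: norm_nonneg add_closed scale_closed)
  show "vdist E x y = vdist E y x"
  proof (cases "x \<in> pts E \<and> y \<in> pts E")
    case True
    then have "vadd E y (vscale E (-1) x) = vscale E (-1) (vadd E x (vscale E (-1) y))"
      by (simp add: scale_add_right scale_closed scale_scale scale_one add_commute)
    with True show ?thesis
      by (simp add: vdist_def norm_scale add_closed scale_closed)
  qed (auto simp: vdist_def)
next
  fix x y assume xy: "x \<in> pts E" "y \<in> pts E"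
  have "x = y" if "vadd E x (vscale E (-1) y) = vzero E"
  proof -
    have "x = vadd E x (vadd E (vscale E (-1) y) y)"
      using xy by (metis add_commute add_neg add_zero scale_closed)
    also have "\<dots> = vadd E (vzero E) y"
      using xy that by (metis add_assoc scale_closed)
    also have "\<dots> = y"
      using xy by (metis add_commute add_zero zero_closed)
    finally show ?thesis .
  qed
  with xy show "vdist E x y = 0 \<longleftrightarrow> x = y"
    by (auto simp: vdist_def norm_eq_zero add_closed scale_closed add_neg)
next
  fix x y z assume xyz: "x \<in> pts E" "y \<in> pts E" "z \<in> pts E"
  define p q where "p = vadd E x (vscale E (-1) y)" and "q = vadd E y (vscale E (-1) z)"
  have pq: "p \<in> pts E" "q \<in> pts E"
    using xyz by (auto simp: p_def q_def add_closed scale_closed)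
  have "vadd E (vscale E (-1) y) q = vscale E (-1) z"
    unfolding q_def using xyz
    by (metis add_assoc add_commute add_neg add_zero scale_closed zero_closed)
  then have "vadd E p q = vadd E x (vscale E (-1) z)"
    unfolding p_def using xyz pq by (simp add: add_assoc scale_closed)
  with norm_triangle[OF pq] show "vdist E x z \<le> vdist E x y + vdist E y z"
    using xyz by (simp add: vdist_def p_def q_def)
qed

text \<open>Trivial spaces have neither property, so nontriviality need not be assumed separately.\<close>

lemma no_convex_comb_if_trivial:
  assumes "pts E = {vzero E}"
  shows "\<not> convex_comb_of_slices E C D"
proof -
  have "f (vzero E) = 0" if "f \<in> dual E" for f
    using that assms add_zero zero_closed by (force simp: dual_def)
  then have "dual_norm E f = 0" if "f \<in> dual E" for f
    using that assms norm_eq_zero zero_closed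
    by (simp add: dual_norm_def unit_ball_def conj_commute cong: conj_cong)
  then have "dual_sphere E = {}"
    by (auto simp: dual_sphere_def)
  then have "\<not> is_slice E C S" for S
    by (simp add: is_slice_def)
  moreover have "n \<noteq> 0" if "(\<Sum>i<n. l i) = (1::real)" for n :: nat and l
    using that by (cases n) auto
  ultimately show ?thesis
    unfolding convex_comb_of_slices_def by blast
qed

end

lemma real_normed_space_subspace_of:
  assumes "subspace Y"
  shows "real_normed_space (subspace_of Y)"
  using assms
  by unfold_locales
    (auto simp: subspace_of_def subspace_add subspace_scale subspace_0 algebra_simps norm_triangle_ineq)

context
  fixes Y :: "'a::real_normed_vector set"
  assumes Y: "subspace Y"
begin

lemma coset_add: "(x +o Y) + (y +o Y) = (x + y) +o Y"
proof -
  have "Y + Y = Y"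
    using Y by (force simp: set_plus_def subspace_add subspace_0 intro: exI[of _ 0])
  then show ?thesis
    by (simp add: set_plus_rearrange)
qed

lemma coset_scale: "(*\<^sub>R) c ` (x +o Y) + Y = (c *\<^sub>R x) +o Y"
proof (intro equalityI subsetI)
  fix z assume "z \<in> (*\<^sub>R) c ` (x +o Y) + Y"
  then obtain y y' where "y \<in> Y" "y' \<in> Y" "z = c *\<^sub>R (x + y) + y'"
    by (auto simp: set_plus_def elt_set_plus_def)
  then show "z \<in> (c *\<^sub>R x) +o Y"
    using Y by (auto simp: elt_set_plus_def algebra_simps subspace_add subspace_scale)
next
  fix z assume "z \<in> (c *\<^sub>R x) +o Y"
  then obtain y where y: "y \<in> Y" "z = c *\<^sub>R x + y"
    by (auto simp: elt_set_plus_def)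
  moreover have "x \<in> x +o Y"
    using Y by (auto simp: elt_set_plus_def subspace_0)
  ultimately show "z \<in> (*\<^sub>R) c ` (x +o Y) + Y"
    by (auto simp: set_plus_def)
qed

lemma coset_eq_iff: "x +o Y = Y \<longleftrightarrow> x \<in> Y"
proof
  assume "x +o Y = Y"
  then show "x \<in> Y"
    using Y by (force simp: elt_set_plus_def subspace_0 intro: bexI[of _ 0])
next
  assume x: "x \<in> Y"
  show "x +o Y = Y"
  proof (intro equalityI subsetI)
    fix z assume "z \<in> Y"
    then have "z - x \<in> Y" "z = x + (z - x)"
      using x Y by (auto simp: subspace_diff)
    then show "z \<in> x +o Y"
      unfolding elt_set_plus_def by blast
  qed (use x Y in \<open>auto simp: elt_set_plus_def subspace_add\<close>)
qed

lemma coset_norm: "(INF a\<in>x +o Y. norm a) = infdist x Y"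
proof -
  have "norm ` (x +o Y) = dist x ` Y"
  proof (intro equalityI subsetI)
    fix r assume "r \<in> norm ` (x +o Y)"
    then obtain y where y: "y \<in> Y" "r = norm (x + y)"
      by (auto simp: elt_set_plus_def)
    then have "r = dist x (- y)" "- y \<in> Y"
      using Y by (auto simp: dist_norm subspace_neg)
    then show "r \<in> dist x ` Y"
      by blast
  next
    fix r assume "r \<in> dist x ` Y"
    then obtain y where y: "y \<in> Y" "r = norm (x + - y)"
      by (auto simp: dist_norm)
    moreover have "x + - y \<in> x +o Y"
      unfolding elt_set_plus_def using Y y by (blast intro: subspace_neg)
    ultimately show "r \<in> norm ` (x +o Y)"
      by blast
  qed
  then show ?thesis
    using Y by (auto simp: infdist_def dest: subspace_0)
qed

lemma real_normed_space_quotient_by: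
  assumes "closed Y"
  shows "real_normed_space (quotient_by Y)"
proof -
  have ne: "Y \<noteq> {}"
    using Y subspace_0 by blast
  have Y0: "0 +o Y = Y"
    using Y coset_eq_iff subspace_0 by blast
  have tri: "infdist (x + y) Y \<le> infdist x Y + infdist y Y" for x y
  proof (rule field_le_epsilon)
    fix e :: real assume "0 < e"
    have approx: "\<exists>b\<in>Y. dist a b < infdist a Y + e / 2" for a
    proof -
      have "(INF b\<in>Y. dist a b) < infdist a Y + e / 2"
        using ne \<open>0 < e\<close> by (simp add: infdist_def)
      then show ?thesis
        using ne by (subst (asm) cINF_less_iff) auto
    qed
    obtain b c where bc: "b \<in> Y" "c \<in> Y"
      "dist x b < infdist x Y + e / 2" "dist y c < infdist y Y + e / 2"
      using approx by meson
    have "infdist (x + y) Y \<le> dist (x + y) (b + c)"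
      using bc Y by (intro infdist_le) (auto simp: subspace_add)
    also have "\<dots> \<le> dist x b + dist y c"
      by (rule dist_triangle_add)
    finally show "infdist (x + y) Y \<le> infdist x Y + infdist y Y + e"
      using bc by simp
  qed
  have scale_le: "infdist (c *\<^sub>R x) Y \<le> \<bar>c\<bar> * infdist x Y" for c x
  proof (cases "c = 0")
    case True
    then show ?thesis using Y by (simp add: subspace_0)
  next
    case False
    have "infdist (c *\<^sub>R x) Y / \<bar>c\<bar> \<le> dist x b" if "b \<in> Y" for b
    proof -
      have "infdist (c *\<^sub>R x) Y \<le> dist (c *\<^sub>R x) (c *\<^sub>R b)"
        using that Y by (intro infdist_le) (auto simp: subspace_scale)
      then show ?thesis
        using False by (simp add: dist_norm pos_divide_le_eq mult.commute flip: scaleR_diff_right)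
    qed
    then have "infdist (c *\<^sub>R x) Y / \<bar>c\<bar> \<le> infdist x Y"
      using ne by (auto simp: infdist_def intro: cINF_greatest)
    then show ?thesis
      using False by (simp add: field_simps)
  qed
  have scale: "infdist (c *\<^sub>R x) Y = \<bar>c\<bar> * infdist x Y" for c x
  proof (cases "c = 0")
    case False
    have "infdist x Y \<le> \<bar>inverse c\<bar> * infdist (c *\<^sub>R x) Y"
      using scale_le[of "inverse c" "c *\<^sub>R x"] False by simp
    then show ?thesis
      using scale_le[of c x] False by (simp add: field_simps)
  qed (use Y in \<open>simp add: subspace_0\<close>)
  have zero: "infdist x Y = 0 \<longleftrightarrow> x +o Y = 0 +o Y" for x
    using assms ne in_closed_iff_infdist_zero coset_eq_iff Y0 by metis
  have pts: "pts (quotient_by Y) = range (\<lambda>x. x +o Y)"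
    and zer: "vzero (quotient_by Y) = 0 +o Y"
    and add: "vadd (quotient_by Y) (x +o Y) (y +o Y) = (x + y) +o Y"
    and scl: "vscale (quotient_by Y) c (x +o Y) = (c *\<^sub>R x) +o Y"
    and nrm: "vnorm (quotient_by Y) (x +o Y) = infdist x Y" for x y c
    using Y0 by (simp_all add: quotient_by_def coset_add coset_scale coset_norm)
  show ?thesis
    by unfold_locales
      (auto simp: pts zer add scl nrm scale tri zero infdist_nonneg
         algebra_simps simp del: set_zero_plus)
qed

end

end

theory Submission
  imports Defs
begin

text \<open>
  Let \<open>S\<^sub>1, \<dots>, S\<^sub>n\<close> be slices of the ball of \<open>Y\<close> whose convex combination has small diameter, and
  extend the functionals defining them to \<open>X\<close> without increasing their norms. If, for each extension
  \<open>f\<close>, some convex combination of slices of the ball of \<open>X\<close> lies in \<open>{f > c}\<close> and within a small distance of \<open>Y\<close>,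
  then each of its points is close to a point of the corresponding \<open>S\<^sub>i\<close>, and combining these sets with the
  weights of the \<open>S\<^sub>i\<close> proves the theorem.

  To find it, consider all sets inside \<open>A = {f > c}\<close> that contain a convex combination of slices of the
  ball and have an image of small diameter in \<open>X/Y\<close>; their union \<open>U\<close> is convex. If \<open>U\<close> stayed away
  from \<open>Y\<close>, some functional \<open>h\<close> vanishing on \<open>Y\<close> would be at least \<open>\<delta>\<close> on \<open>U\<close>. Strong regularity
  applied to the closure of the image of \<open>A \<inter> {h < \<delta>}\<close>, a nonempty set because \<open>A\<close> meets \<open>Y\<close>, gives a
  small combination of slices of that closure. The preimage of such a slice in \<open>A \<inter> {h < \<delta>}\<close> is cut out
  of the ball of \<open>X\<close> by three functionals and so contains a convex combination of slices of the ball
  (Bourgain's lemma). Hence \<open>U\<close> meets \<open>{h < \<delta>}\<close>, a contradiction.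
\<close>

section \<open>The Hahn-Banach theorem\<close>

text \<open>Scaling is required only as an inequality, which is what the constructions below verify;
  \<open>sublinear_scale\<close> recovers equality by using the scalar \<open>inverse c\<close> as
  well.\<close>

definition sublinear :: "('a::real_vector \<Rightarrow> real) \<Rightarrow> bool" where
  "sublinear p \<longleftrightarrow> (\<forall>x y. p (x + y) \<le> p x + p y) \<and> (\<forall>c\<ge>0. \<forall>x. p (c *\<^sub>R x) \<le> c * p x)"

lemma sublinear_add: "sublinear p \<Longrightarrow> p (x + y) \<le> p x + p y"
  and sublinear_scale_le: "sublinear p \<Longrightarrow> 0 \<le> c \<Longrightarrow> p (c *\<^sub>R x) \<le> c * p x"
  by (simp_all add: sublinear_def)

lemma sublinear_zero: "sublinear p \<Longrightarrow> p 0 = 0"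
  using sublinear_add[of p 0 0] sublinear_scale_le[of p 0 0] by simp

lemma sublinear_scale:
  assumes "sublinear p" "0 \<le> c"
  shows "p (c *\<^sub>R x) = c * p x"
proof (cases "c = 0")
  case False
  with sublinear_scale_le[OF assms(1), of "inverse c" "c *\<^sub>R x"] assms(2)
  have "c * p x \<le> p (c *\<^sub>R x)"
    by (simp add: field_simps)
  then show ?thesis
    using sublinear_scale_le[OF assms, of x] by simp
qed (use assms sublinear_zero in auto)

lemma sublinear_minus: "sublinear p \<Longrightarrow> - p (- x) \<le> p x"
  using sublinear_add[of p x "- x"] sublinear_zero[of p] by simp

text \<open>This provides the lower bounds that Zorn's lemma asks for. The infimum is finite because
  every member dominates \<open>- p (- x)\<close>. It is subadditive because the smaller of two
  members of the chain may be evaluated at both points.\<close>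

lemma sublinear_Inf_chain:
  assumes "C \<noteq> {}" and sub: "\<And>q. q \<in> C \<Longrightarrow> sublinear q \<and> q \<le> p"
    and chain: "\<And>q r. \<lbrakk>q \<in> C; r \<in> C\<rbrakk> \<Longrightarrow> q \<le> r \<or> r \<le> q"
  shows "sublinear (\<lambda>x. INF q\<in>C. q x)" and "\<And>q x. q \<in> C \<Longrightarrow> (INF q\<in>C. q x) \<le> q x"
proof -
  have "- p (- x) \<le> q x" if "q \<in> C" for q x
    using sub[OF that] sublinear_minus[of q x] le_funD[of q p "- x"] by force
  then have bdd: "bdd_below ((\<lambda>q. q x) ` C)" for x
    by (intro bdd_belowI2)
  show le: "(INF q\<in>C. q x) \<le> q x" if "q \<in> C" for q x
    using that bdd by (rule cINF_lower[rotated])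
  have "(INF q\<in>C. q (x + y)) \<le> (INF q\<in>C. q x) + (INF q\<in>C. q y)" for x y
  proof -
    have *: "(INF q\<in>C. q (x + y)) \<le> q x + r y" if "q \<in> C" "r \<in> C" for q r
      using chain[OF that]
    proof
      assume "q \<le> r"
      have "(INF q\<in>C. q (x + y)) \<le> q (x + y)"
        using that by (intro le)
      also have "\<dots> \<le> q x + q y"
        using sub[OF that(1)] by (simp add: sublinear_add)
      finally show ?thesis
        using le_funD[OF \<open>q \<le> r\<close>, of y] by linarith
    next
      assume "r \<le> q"
      have "(INF q\<in>C. q (x + y)) \<le> r (x + y)"
        using that by (intro le)
      also have "\<dots> \<le> r x + r y"
        using sub[OF that(2)] by (simp add: sublinear_add)
      finally show ?thesis
        using le_funD[OF \<open>r \<le> q\<close>, of x] by linarith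
    qed
    have "(INF q\<in>C. q (x + y)) - r y \<le> (INF q\<in>C. q x)" if "r \<in> C" for r
      using \<open>C \<noteq> {}\<close> * that by (intro cINF_greatest) (auto simp: diff_le_eq)
    then have "(INF q\<in>C. q (x + y)) - (INF q\<in>C. q x) \<le> (INF r\<in>C. r y)"
      using \<open>C \<noteq> {}\<close> by (intro cINF_greatest) (auto simp: algebra_simps)
    then show ?thesis by simp
  qed
  moreover have "(INF q\<in>C. q (c *\<^sub>R x)) \<le> c * (INF q\<in>C. q x)" if "0 \<le> c" for c x
  proof (cases "c = 0")
    case True
    then show ?thesis
      using \<open>C \<noteq> {}\<close> sub by (simp add: sublinear_zero)
  next
    case False
    have "(INF q\<in>C. q (c *\<^sub>R x)) / c \<le> q x" if "q \<in> C" for q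
      using le[OF that, of "c *\<^sub>R x"] sublinear_scale[of q c x] sub[OF that] \<open>0 \<le> c\<close> False
      by (simp add: field_simps)
    then have "(INF q\<in>C. q (c *\<^sub>R x)) / c \<le> (INF q\<in>C. q x)"
      using \<open>C \<noteq> {}\<close> by (intro cINF_greatest)
    then show ?thesis
      using \<open>0 \<le> c\<close> False by (simp add: field_simps)
  qed
  ultimately show "sublinear (\<lambda>x. INF q\<in>C. q x)"
    by (simp add: sublinear_def)
qed

lemma exists_minimal_sublinear:
  assumes "sublinear p"
  obtains m where "sublinear m" "m \<le> p" "\<And>q. \<lbrakk>sublinear q; q \<le> m\<rbrakk> \<Longrightarrow> q = m"
proof -
  let ?A = "{q. sublinear q \<and> q \<le> p}"
  have "\<exists>m\<in>?A. \<forall>q\<in>?A. q \<le> m \<longrightarrow> q = m"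
  proof (rule predicate_Zorn)
    \<comment> \<open>The order is reversed, since Zorn's lemma yields maximal elements.\<close>
    show "partial_order_on ?A (relation_of (\<lambda>q r. r \<le> q) ?A)"
      by (auto simp: relation_of_def partial_order_on_def preorder_on_def refl_on_def trans_def
          antisym_def intro: order_trans)
  next
    fix C assume C: "C \<in> Chains (relation_of (\<lambda>q r. r \<le> q) ?A)"
    show "\<exists>u\<in>?A. \<forall>q\<in>C. u \<le> q"
    proof (cases "C = {}")
      case False
      have "\<And>q. q \<in> C \<Longrightarrow> sublinear q \<and> q \<le> p"
        using Chains_relation_of[OF C] by auto
      moreover have "\<And>q r. \<lbrakk>q \<in> C; r \<in> C\<rbrakk> \<Longrightarrow> q \<le> r \<or> r \<le> q"
        using C by (auto simp: Chains_def relation_of_def)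
      ultimately have *: "sublinear (\<lambda>x. INF q\<in>C. q x)"
        "\<And>q x. q \<in> C \<Longrightarrow> (INF q\<in>C. q x) \<le> q x"
        and "\<And>q. q \<in> C \<Longrightarrow> q \<le> p"
        using sublinear_Inf_chain[OF False] by blast+
      then have "(\<lambda>x. INF q\<in>C. q x) \<le> q" if "q \<in> C" for q
        using that by (auto intro: le_funI)
      moreover have "(\<lambda>x. INF q\<in>C. q x) \<le> p"
        using calculation \<open>\<And>q. q \<in> C \<Longrightarrow> q \<le> p\<close> False by (meson ex_in_conv order_trans)
      ultimately show ?thesis
        using *(1) by blast
    qed (use assms in auto)
  qed
  then show thesis
    using that by (auto intro: order_trans)
qed

text \<open>The witness is \<open>x \<mapsto> inf {p (x + v) - s | (v, s) \<in> P}\<close>.\<close>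

lemma sublinear_below_cone:
  assumes p: "sublinear p" and P: "convex_cone P"
    and dom: "\<And>v s. (v, s) \<in> P \<Longrightarrow> s \<le> p v"
  obtains q where "sublinear q" "q \<le> p" "\<And>v s. (v, s) \<in> P \<Longrightarrow> q (- v) \<le> - s"
proof -
  define q where "q = (\<lambda>x. INF w\<in>P. p (x + fst w) - snd w)"
  have ne: "P \<noteq> {}" and zero: "(0, 0) \<in> P"
    using convex_cone_nonempty[OF P] convex_cone_contains_0[OF P] by (auto simp: zero_prod_def)
  \<comment> \<open>For \<open>w = (v, s)\<close> one has
    \<open>s \<le> p v \<le> p (x + v) + p (- x)\<close>. This bounds the infimum defining
    \<open>q\<close> from below.\<close>
  have "- p (- x) \<le> p (x + fst w) - snd w" if "w \<in> P" for x w
    using dom[of "fst w" "snd w"] that sublinear_add[OF p, of "x + fst w" "- x"] by simp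
  then have "bdd_below ((\<lambda>w. p (x + fst w) - snd w) ` P)" for x
    by (intro bdd_belowI2)
  then have le: "q x \<le> p (x + fst w) - snd w" if "w \<in> P" for x w
    unfolding q_def using that by (intro cINF_lower)
  have ge: "a \<le> q x" if "\<And>w. w \<in> P \<Longrightarrow> a \<le> p (x + fst w) - snd w" for a x
    unfolding q_def using that ne by (intro cINF_greatest)
  show thesis
  proof
    show "q \<le> p"
      using le[OF zero] by (auto intro: le_funI)
    show "q (- v) \<le> - s" if "(v, s) \<in> P" for v s
      using le[OF that, of "- v"] sublinear_zero[OF p] by simp
    have "q (x + y) \<le> q x + q y" for x y
    proof -
      have *: "q (x + y) \<le> (p (x + fst v) - snd v) + (p (y + fst w) - snd w)"
        if "v \<in> P" "w \<in> P" for v w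
      proof -
        have "v + w \<in> P"
          using that by (intro convex_cone_add[OF P])
        from le[OF this, of "x + y"] show ?thesis
          using sublinear_add[OF p, of "x + fst v" "y + fst w"] by (simp add: algebra_simps)
      qed
      have "q (x + y) - (p (y + fst w) - snd w) \<le> q x" if "w \<in> P" for w
        using *[OF _ that] by (intro ge) (simp add: algebra_simps)
      then have "q (x + y) - q x \<le> q y"
        by (intro ge) (simp add: algebra_simps)
      then show ?thesis by simp
    qed
    moreover have "q (c *\<^sub>R x) \<le> c * q x" if "0 \<le> c" for c x
    proof (cases "c = 0")
      case True
      then show ?thesis
        using le[OF zero, of 0] sublinear_zero[OF p] by simp
    next
      case False
      then have "0 < c" using that by simp
      have "q (c *\<^sub>R x) / c \<le> p (x + fst w) - snd w" if "w \<in> P" for w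
      proof -
        have "c *\<^sub>R w \<in> P"
          using that \<open>0 < c\<close> by (intro convex_cone_scaleR[OF P]) auto
        from le[OF this, of "c *\<^sub>R x"] show ?thesis
          using sublinear_scale[OF p, of c "x + fst w"] \<open>0 < c\<close>
          by (simp add: field_simps scaleR_add_right)
      qed
      then have "q (c *\<^sub>R x) / c \<le> q x"
        by (rule ge)
      then show ?thesis
        using \<open>0 < c\<close> by (simp add: field_simps)
    qed
    ultimately show "sublinear q"
      by (simp add: sublinear_def)
  qed
qed

text \<open>The cone lemma for the ray through \<open>(z, m z)\<close> gives a sublinear function
  below \<open>m\<close> whose value at \<open>- z\<close> is at most \<open>- m z\<close>. By
  minimality it equals \<open>m\<close>, so \<open>m\<close> is odd, and an odd sublinear function
  is linear.\<close>

lemma minimal_sublinear_linear: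
  assumes m: "sublinear m" and min: "\<And>q. \<lbrakk>sublinear q; q \<le> m\<rbrakk> \<Longrightarrow> q = m"
  shows "linear m"
proof -
  have neg: "m (- z) = - m z" for z
  proof -
    let ?P = "conic hull {(z, m z)}"
    have "convex_cone ?P"
      by (simp add: convex_cone_def conic_hull_eq_empty convex_conic_hull conic_conic_hull)
    moreover have "\<And>v s. (v, s) \<in> ?P \<Longrightarrow> s \<le> m v"
      using sublinear_scale[OF m] by (auto simp: conic_hull_explicit)
    ultimately obtain q where q: "sublinear q" "q \<le> m" "\<And>v s. (v, s) \<in> ?P \<Longrightarrow> q (- v) \<le> - s"
      using sublinear_below_cone[OF m] by metis
    have "(z, m z) \<in> ?P"
      by (simp add: hull_inc)
    with q min have "m (- z) \<le> - m z"
      by metis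
    then show ?thesis
      using sublinear_minus[OF m, of z] by simp
  qed
  have "m (x + y) = m x + m y" for x y
    using sublinear_add[OF m, of x y] sublinear_add[OF m, of "- x" "- y"] neg[of x] neg[of y]
      neg[of "x + y"] by simp
  moreover have "m (c *\<^sub>R x) = c * m x" for c x
    using sublinear_scale[OF m, of "\<bar>c\<bar>" x] neg[of "\<bar>c\<bar> *\<^sub>R x"]
    by (cases "0 \<le> c") auto
  ultimately show ?thesis
    by (intro linearI) auto
qed

text \<open>One form of Hahn-Banach serves both for extension, where \<open>P\<close> is the graph
  of a functional, and for separation, where \<open>P\<close> is the cone over a convex set. A
  minimal \<open>F\<close> below the function of the cone lemma is linear, so
  \<open>F (- v) \<le> - s\<close> turns into \<open>s \<le> F v\<close>.\<close>

theorem Mazur_Orlicz_cone: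
  assumes "sublinear p" "convex_cone P" "\<And>v s. (v, s) \<in> P \<Longrightarrow> s \<le> p v"
  obtains F where "linear F" "\<And>x. F x \<le> p x" "\<And>v s. (v, s) \<in> P \<Longrightarrow> s \<le> F v"
proof -
  obtain q where q: "sublinear q" "q \<le> p" "\<And>v s. (v, s) \<in> P \<Longrightarrow> q (- v) \<le> - s"
    using sublinear_below_cone[OF assms] by blast
  obtain F where F: "sublinear F" "F \<le> q" "\<And>r. \<lbrakk>sublinear r; r \<le> F\<rbrakk> \<Longrightarrow> r = F"
    using exists_minimal_sublinear[OF q(1)] by blast
  show thesis
  proof
    show lin: "linear F"
      using F minimal_sublinear_linear by blast
    show "F x \<le> p x" for x
      using F(2) q(2) by (meson le_funD order_trans)
    show "s \<le> F v" if "(v, s) \<in> P" for v s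
      using q(3)[OF that] le_funD[OF F(2), of "- v"] linear_neg[OF lin, of v] by simp
  qed
qed

lemma sublinear_norm: "sublinear norm"
  by (simp add: sublinear_def norm_triangle_ineq)

lemma linear_le_norm:
  fixes F :: "'a::real_normed_vector \<Rightarrow> real"
  assumes F: "linear F" "\<And>x. F x \<le> norm x"
  shows "\<bar>F x\<bar> \<le> norm x" and "bounded_linear F"
proof -
  show "\<bar>F x\<bar> \<le> norm x" for x
    using F(2)[of x] F(2)[of "- x"] linear_neg[OF F(1), of x] by simp
  then show "bounded_linear F"
    using F(1) by (intro bounded_linear_intro[of F 1]) (auto simp: linear_add linear_scale)
qed

text \<open>Domination on the graph of \<open>f\<close> is one-sided, but the graph contains the
  negatives of its points, so \<open>f \<le> F\<close> on \<open>Y\<close> becomes equality.\<close>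

theorem Hahn_Banach_extension:
  fixes Y :: "'a::real_normed_vector set"
  assumes Y: "subspace Y" and add: "\<And>x y. \<lbrakk>x \<in> Y; y \<in> Y\<rbrakk> \<Longrightarrow> f (x + y) = f x + f y"
    and scale: "\<And>c x. x \<in> Y \<Longrightarrow> f (c *\<^sub>R x) = c * f x"
    and bound: "\<And>x. x \<in> Y \<Longrightarrow> \<bar>f x\<bar> \<le> norm x"
  obtains F where "bounded_linear F" "\<And>x. \<bar>F x\<bar> \<le> norm x" "\<And>y. y \<in> Y \<Longrightarrow> F y = f y"
proof -
  let ?P = "(\<lambda>y. (y, f y)) ` Y"
  have "f 0 = 0"
    using scale[of 0 0] Y by (simp add: subspace_0)
  then have "convex_cone ?P"
    using Y by (auto simp: convex_cone_iff zero_prod_def image_def add scale subspace_add subspace_scale subspace_0)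
  moreover have "\<And>v s. (v, s) \<in> ?P \<Longrightarrow> s \<le> norm v"
    using bound abs_le_D1 by blast
  ultimately obtain F where F: "linear F" "\<And>x. F x \<le> norm x" "\<And>v s. (v, s) \<in> ?P \<Longrightarrow> s \<le> F v"
    using Mazur_Orlicz_cone[OF sublinear_norm] by blast
  have "F y = f y" if "y \<in> Y" for y
  proof -
    have "f y \<le> F y" "f (- y) \<le> F (- y)"
      using F(3) that Y by (auto intro: subspace_neg)
    then show ?thesis
      using scale[OF that, of "-1"] linear_neg[OF F(1), of y] by simp
  qed
  with that linear_le_norm[OF F(1,2)] show thesis by blast
qed

section \<open>Distance to a closed subspace and separation from it\<close>

lemma vnorm_coset: "subspace Y \<Longrightarrow> vnorm (quotient_by Y) (x +o Y) = infdist x Y"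
  by (simp add: quotient_by_def coset_norm)

lemma infdist_add_subspace:
  fixes Y :: "'a::real_normed_vector set"
  assumes "subspace Y" "closed Y"
  shows "infdist (x + y) Y \<le> infdist x Y + infdist y Y"
  using real_normed_space.norm_triangle[OF real_normed_space_quotient_by[OF assms], of "x +o Y" "y +o Y"]
  by (simp add: vnorm_coset assms coset_add quotient_by_def coset_norm)

lemma infdist_scaleR_subspace:
  fixes Y :: "'a::real_normed_vector set"
  assumes "subspace Y" "closed Y"
  shows "infdist (c *\<^sub>R x) Y = \<bar>c\<bar> * infdist x Y"
  using real_normed_space.norm_scale[OF real_normed_space_quotient_by[OF assms], of "x +o Y" c]
  by (simp add: assms coset_scale quotient_by_def coset_norm)

lemma infdist_le_norm: "subspace Y \<Longrightarrow> infdist x Y \<le> norm x"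
  using infdist_le[of 0 Y x] subspace_0[of Y] by simp

lemma infdist_lessE:
  assumes "subspace Y" "infdist x Y < r"
  obtains y where "y \<in> Y" "dist x y < r"
  using assms subspace_0[OF assms(1)] by (auto simp: infdist_def cINF_less_iff split: if_splits)

text \<open>Dominating \<open>h\<close> by the distance to \<open>Y\<close> makes it nonpositive on
  \<open>Y\<close>, hence zero there by symmetry, and still keeps it below the norm. The cone over
  \<open>U\<close> at height \<delta> encodes the lower bound on \<open>U\<close>.\<close>

lemma separate_convex_from_subspace:
  fixes Y :: "'a::real_normed_vector set"
  assumes Y: "subspace Y" "closed Y" and U: "convex U" "U \<noteq> {}"
    and far: "\<And>x. x \<in> U \<Longrightarrow> \<delta> \<le> infdist x Y"
  obtains h where "bounded_linear h" "\<And>x. \<bar>h x\<bar> \<le> norm x" "\<And>y. y \<in> Y \<Longrightarrow> h y = 0"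
    "\<And>x. x \<in> U \<Longrightarrow> \<delta> \<le> h x"
proof -
  let ?p = "\<lambda>x. infdist x Y"
  let ?P = "conic hull (U \<times> {\<delta>})"
  have p: "sublinear ?p"
    using Y by (simp add: sublinear_def infdist_add_subspace infdist_scaleR_subspace)
  have "convex_cone ?P"
    using U by (simp add: convex_cone_def conic_hull_eq_empty convex_conic_hull conic_conic_hull convex_Times)
  moreover have "\<And>v s. (v, s) \<in> ?P \<Longrightarrow> s \<le> ?p v"
    using Y far by (auto simp: conic_hull_explicit infdist_scaleR_subspace mult_left_mono)
  ultimately obtain h where h: "linear h" "\<And>x. h x \<le> ?p x" "\<And>v s. (v, s) \<in> ?P \<Longrightarrow> s \<le> h v"
    using Mazur_Orlicz_cone[OF p] by blast
  show thesis
  proof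
    have "h x \<le> norm x" for x
      using h(2) infdist_le_norm[OF Y(1)] order_trans by blast
    then show "bounded_linear h" "\<bar>h x\<bar> \<le> norm x" for x
      using h(1) linear_le_norm by blast+
    show "h y = 0" if "y \<in> Y" for y
      using h(2)[of y] h(2)[of "- y"] that Y(1) linear_neg[OF h(1), of y]
      by (simp add: subspace_neg)
    show "\<delta> \<le> h x" if "x \<in> U" for x
      using that by (intro h(3)) (simp add: hull_inc)
  qed
qed

section \<open>Sets containing a convex combination of slices\<close>

abbreviation whole_space :: "'a::real_normed_vector nspace" where
  "whole_space \<equiv> subspace_of UNIV"

lemma minkowski_comb_subspace_of:
  "minkowski_comb (subspace_of Y) l S n = (\<Sum>i<n. (*\<^sub>R) (l i) ` S i)"
proof (induction n)
  case (Suc n)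
  then show ?case
    unfolding minkowski_comb.simps sum.lessThan_Suc set_plus_def by (auto simp: subspace_of_def)
qed (simp add: subspace_of_def)

lemma set_sum_scaleR_imageE:
  assumes "finite I" "y \<in> (\<Sum>i\<in>I. (*\<^sub>R) (l i) ` W i)"
  obtains w where "\<forall>i\<in>I. w i \<in> W i" "y = (\<Sum>i\<in>I. l i *\<^sub>R w i)"
proof -
  obtain s where s: "y = sum s I" "\<forall>i\<in>I. s i \<in> (*\<^sub>R) (l i) ` W i"
    using assms by (auto simp: set_sum_alt)
  then have "\<forall>i\<in>I. \<exists>w. w \<in> W i \<and> s i = l i *\<^sub>R w"
    by blast
  then obtain w where "\<forall>i\<in>I. w i \<in> W i \<and> s i = l i *\<^sub>R w i"
    by metis
  with s(1) that[of w] show thesis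
    by simp
qed

lemma sum_scaleR_image_subset_convex:
  fixes A :: "'a::real_vector set"
  assumes "convex A" "finite I" "\<And>i. i \<in> I \<Longrightarrow> 0 \<le> l i" "sum l I = 1" "\<And>i. i \<in> I \<Longrightarrow> W i \<subseteq> A"
  shows "(\<Sum>i\<in>I. (*\<^sub>R) (l i) ` W i) \<subseteq> A"
proof
  fix y assume "y \<in> (\<Sum>i\<in>I. (*\<^sub>R) (l i) ` W i)"
  with assms(2) obtain w where "\<forall>i\<in>I. w i \<in> W i" "y = (\<Sum>i\<in>I. l i *\<^sub>R w i)"
    by (rule set_sum_scaleR_imageE)
  with assms show "y \<in> A"
    by (auto intro!: convex_sum)
qed

text \<open>Asking for containment makes the property monotone in \<open>W\<close>. A free total
  weight \<open>s\<close> lets scaled sets be added one at a time; \<open>s = 1\<close> gives convex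
  combinations, see \<open>contains_comb_iff\<close>.\<close>

definition contains_comb :: "'a::real_normed_vector set \<Rightarrow> real \<Rightarrow> 'a set \<Rightarrow> bool" where
  "contains_comb C s W \<longleftrightarrow>
     (\<exists>(n::nat) l S. (\<forall>i<n. 0 \<le> l i \<and> is_slice whole_space C (S i)) \<and> (\<Sum>i<n. l i) = s \<and>
        (\<Sum>i<n. (*\<^sub>R) (l i) ` S i) \<subseteq> W)"

lemma contains_combI:
  fixes n :: nat
  assumes "\<forall>i<n. 0 \<le> l i" "\<forall>i<n. is_slice whole_space C (S i)"
    and "(\<Sum>i<n. l i) = s" "(\<Sum>i<n. (*\<^sub>R) (l i) ` S i) \<subseteq> W"
  shows "contains_comb C s W"
  using assms unfolding contains_comb_def by metis

lemma contains_combE: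
  assumes "contains_comb C s W"
  obtains n :: nat and l S
  where "\<forall>i<n. 0 \<le> l i" "\<forall>i<n. is_slice whole_space C (S i)"
    and "(\<Sum>i<n. l i) = s" "(\<Sum>i<n. (*\<^sub>R) (l i) ` S i) \<subseteq> W"
  using assms unfolding contains_comb_def by metis

lemma contains_comb_iff:
  "contains_comb C 1 W \<longleftrightarrow> (\<exists>D\<subseteq>W. convex_comb_of_slices whole_space C D)"
  unfolding contains_comb_def convex_comb_of_slices_def minkowski_comb_subspace_of by blast

lemma contains_comb_mono: "contains_comb C s V \<Longrightarrow> V \<subseteq> W \<Longrightarrow> contains_comb C s W"
  unfolding contains_comb_def by (blast intro: order_trans)

lemma contains_comb_slice: "is_slice whole_space C S \<Longrightarrow> contains_comb C 1 S"
  unfolding contains_comb_def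
  by (rule exI[of _ 1], rule exI[of _ "\<lambda>_. 1"], rule exI[of _ "\<lambda>_. S"])
    (simp add: lessThan_Suc)

lemma contains_comb_zero: "contains_comb C 0 {0}"
  unfolding contains_comb_def by (rule exI[of _ 0]) simp

lemma contains_comb_add:
  assumes "contains_comb C s V" "contains_comb C t W"
  shows "contains_comb C (s + t) (V + W)"
proof -
  obtain n :: nat and l S
    where 1: "\<forall>i<n. 0 \<le> l i" "\<forall>i<n. is_slice whole_space C (S i)"
      "(\<Sum>i<n. l i) = s" "(\<Sum>i<n. (*\<^sub>R) (l i) ` S i) \<subseteq> V"
    using assms(1) by (rule contains_combE)
  obtain m :: nat and k T
    where 2: "\<forall>i<m. 0 \<le> k i" "\<forall>i<m. is_slice whole_space C (T i)"
      "(\<Sum>i<m. k i) = t" "(\<Sum>i<m. (*\<^sub>R) (k i) ` T i) \<subseteq> W"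
    using assms(2) by (rule contains_combE)
  \<comment> \<open>The two families are concatenated, the second one shifted by
    \<open>n\<close>.\<close>
  define l' where "l' i = (if i < n then l i else k (i - n))" for i
  define S' where "S' i = (if i < n then S i else T (i - n))" for i
  have split: "(\<Sum>i<n + m. g i) = (\<Sum>i<n. g i) + (\<Sum>i<m. g (n + i))"
    for g :: "nat \<Rightarrow> 'b::comm_monoid_add"
    by (induction m) (simp_all add: add.assoc)
  show ?thesis
  proof (rule contains_combI)
    show "(\<Sum>i<n + m. l' i) = s + t"
      using 1(3) 2(3) by (simp add: split l'_def)
    show "(\<Sum>i<n + m. (*\<^sub>R) (l' i) ` S' i) \<subseteq> V + W"
      using set_plus_mono2[OF 1(4) 2(4)] by (simp add: split l'_def S'_def)
    show "\<forall>i<n + m. 0 \<le> l' i" "\<forall>i<n + m. is_slice whole_space C (S' i)"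
      using 1(1,2) 2(1,2) by (auto simp: l'_def S'_def)
  qed
qed

lemma contains_comb_scale:
  assumes "contains_comb C s W" "0 \<le> c"
  shows "contains_comb C (c * s) ((*\<^sub>R) c ` W)"
proof -
  obtain n :: nat and l S
    where *: "\<forall>i<n. 0 \<le> l i" "\<forall>i<n. is_slice whole_space C (S i)"
      "(\<Sum>i<n. l i) = s" "(\<Sum>i<n. (*\<^sub>R) (l i) ` S i) \<subseteq> W"
    using assms(1) by (rule contains_combE)
  have "(*\<^sub>R) c ` (\<Sum>i<n. (*\<^sub>R) (l i) ` S i) = (\<Sum>i<n. (*\<^sub>R) (c * l i) ` S i)"
  proof (induction n)
    case (Suc n)
    have "(*\<^sub>R) c ` (A + B) = (*\<^sub>R) c ` A + (*\<^sub>R) c ` B" for A B :: "'a set"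
      by (force simp: set_plus_def scaleR_add_right image_iff)
    with Suc show ?case
      by (simp add: image_image)
  qed simp
  with image_mono[OF *(4), of "(*\<^sub>R) c"]
  have "(\<Sum>i<n. (*\<^sub>R) (c * l i) ` S i) \<subseteq> (*\<^sub>R) c ` W"
    by simp
  moreover have "(\<Sum>i<n. c * l i) = c * s"
    using *(3) by (simp flip: sum_distrib_left)
  ultimately show ?thesis
    using *(1,2) assms(2) by (intro contains_combI[of n "\<lambda>i. c * l i" C S]) auto
qed

lemma contains_comb_sum:
  assumes "finite I" "\<And>i. i \<in> I \<Longrightarrow> 0 \<le> l i \<and> contains_comb C 1 (W i)"
  shows "contains_comb C (\<Sum>i\<in>I. l i) (\<Sum>i\<in>I. (*\<^sub>R) (l i) ` W i)"
  using assms
proof (induction I rule: finite_induct)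
  case (insert i I)
  then have "contains_comb C (l i) ((*\<^sub>R) (l i) ` W i)"
    using contains_comb_scale[of C 1 "W i" "l i"] by simp
  with insert show ?case
    by (simp add: contains_comb_add)
qed (simp add: contains_comb_zero)

section \<open>Functionals, dual norms and slices of unit balls\<close>

lemma dual_whole_space: "f \<in> dual whole_space \<longleftrightarrow> bounded_linear f"
proof
  assume "f \<in> dual whole_space"
  then obtain K where "\<And>x y. f (x + y) = f x + f y" "\<And>c x. f (c *\<^sub>R x) = c * f x"
    and "\<And>x. \<bar>f x\<bar> \<le> K * norm x"
    by (auto simp: dual_def subspace_of_def)
  then show "bounded_linear f"
    by (intro bounded_linear_intro[of f K]) (auto simp: mult.commute)
next
  assume "bounded_linear f"
  then interpret bounded_linear f .
  show "f \<in> dual whole_space"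
    using bounded by (simp add: dual_def subspace_of_def add scale mult.commute)
qed

lemma unit_ball_subspace_of: "unit_ball (subspace_of Y) = Y \<inter> cball 0 1"
  by (auto simp: unit_ball_def subspace_of_def)

lemma slice_nonempty:
  assumes "C \<noteq> {}" "bdd_above (f ` C)" "0 < \<alpha>"
  shows "slice C f \<alpha> \<noteq> {}"
  using less_cSUP_iff[OF assms(1,2), of "(SUP z\<in>C. f z) - \<alpha>"] assms(3) by (auto simp: slice_def)

context
  fixes Y :: "'a::real_normed_vector set" and f :: "'a \<Rightarrow> real"
  assumes Y: "subspace Y" and f: "f \<in> dual (subspace_of Y)"
begin

lemma dual_subspace_scale: "x \<in> Y \<Longrightarrow> f (c *\<^sub>R x) = c * f x"
  using f by (simp add: dual_def subspace_of_def)

lemma dual_subspace_add: "x \<in> Y \<Longrightarrow> y \<in> Y \<Longrightarrow> f (x + y) = f x + f y"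
  using f by (simp add: dual_def subspace_of_def)

lemma dual_subspace_bdd_above: "bdd_above ((\<lambda>x. \<bar>f x\<bar>) ` (Y \<inter> cball 0 1))"
proof -
  obtain K where K: "\<And>x. x \<in> Y \<Longrightarrow> \<bar>f x\<bar> \<le> K * norm x"
    using f unfolding dual_def subspace_of_def by simp metis
  have "\<bar>f x\<bar> \<le> \<bar>K\<bar>" if "x \<in> Y \<inter> cball 0 1" for x
  proof -
    have "\<bar>f x\<bar> \<le> \<bar>K\<bar> * norm x"
      using K[of x] that by (meson Int_iff abs_ge_self mult_right_mono norm_ge_zero order_trans)
    also have "\<dots> \<le> \<bar>K\<bar>"
      using that by (simp add: mult_left_le)
    finally show ?thesis .
  qed
  then show ?thesis
    by (intro bdd_aboveI2)
qed

lemma abs_le_dual_norm: "x \<in> Y \<inter> cball 0 1 \<Longrightarrow> \<bar>f x\<bar> \<le> dual_norm (subspace_of Y) f"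
  unfolding dual_norm_def unit_ball_subspace_of
  using dual_subspace_bdd_above by (rule cSUP_upper[rotated])

lemma abs_le_dual_norm_mult:
  assumes "x \<in> Y"
  shows "\<bar>f x\<bar> \<le> dual_norm (subspace_of Y) f * norm x"
proof (cases "x = 0")
  case True
  then show ?thesis
    using dual_subspace_scale[OF assms, of 0] by simp
next
  case False
  have "x /\<^sub>R norm x \<in> Y \<inter> cball 0 1"
    using assms Y False by (simp add: subspace_scale)
  from abs_le_dual_norm[OF this] show ?thesis
    using False assms by (simp add: dual_subspace_scale abs_mult field_simps)
qed

lemma dual_norm_least:
  assumes "\<And>x. x \<in> Y \<inter> cball 0 1 \<Longrightarrow> \<bar>f x\<bar> \<le> c"
  shows "dual_norm (subspace_of Y) f \<le> c"
  unfolding dual_norm_def unit_ball_subspace_of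
  using assms subspace_0[OF Y] by (intro cSUP_least) auto

lemma dual_norm_nonneg: "0 \<le> dual_norm (subspace_of Y) f"
  using abs_le_dual_norm[of 0] subspace_0[OF Y] by (simp add: order_trans[OF abs_ge_zero])

lemma bdd_above_ball: "bdd_above (f ` (Y \<inter> cball 0 1))"
  using abs_le_dual_norm by (intro bdd_aboveI2) (rule abs_le_D1)

text \<open>The ball is symmetric, so the absolute value in the dual norm does not change the
  supremum. Slices of a ball thereby become the explicit sets of \<open>slice_ball\<close>.\<close>

lemma SUP_ball_eq_dual_norm: "(SUP z\<in>Y \<inter> cball 0 1. f z) = dual_norm (subspace_of Y) f"
proof (rule antisym)
  show "(SUP z\<in>Y \<inter> cball 0 1. f z) \<le> dual_norm (subspace_of Y) f"
    using subspace_0[OF Y] by (intro cSUP_least abs_le_D1[OF abs_le_dual_norm]) auto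
  show "dual_norm (subspace_of Y) f \<le> (SUP z\<in>Y \<inter> cball 0 1. f z)"
  proof (rule dual_norm_least)
    fix x assume x: "x \<in> Y \<inter> cball 0 1"
    then have "- x \<in> Y \<inter> cball 0 1"
      using Y by (simp add: subspace_neg)
    then show "\<bar>f x\<bar> \<le> (SUP z\<in>Y \<inter> cball 0 1. f z)"
      using cSUP_upper[OF x bdd_above_ball] cSUP_upper[OF _ bdd_above_ball, of "- x"]
        dual_subspace_scale[of x "-1"] x by auto
  qed
qed

lemma slice_ball:
  "slice (Y \<inter> cball 0 1) f \<alpha> = {x \<in> Y \<inter> cball 0 1. dual_norm (subspace_of Y) f - \<alpha> < f x}"
  by (simp add: slice_def SUP_ball_eq_dual_norm)

end

lemma unit_ball_whole_space: "unit_ball whole_space = cball 0 1"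
  by (simp add: unit_ball_subspace_of)

lemma dual_sphere_normalize:
  assumes "bounded_linear \<phi>" "dual_norm whole_space \<phi> \<noteq> 0"
  shows "(\<lambda>x. \<phi> x / dual_norm whole_space \<phi>) \<in> dual_sphere whole_space"
proof -
  let ?N = "dual_norm whole_space \<phi>" and ?g = "\<lambda>x. \<phi> x / dual_norm whole_space \<phi>"
  have \<phi>: "\<phi> \<in> dual whole_space"
    using assms(1) by (simp add: dual_whole_space)
  have "0 < ?N"
    using dual_norm_nonneg[OF subspace_UNIV \<phi>] assms(2) by simp
  have g: "?g \<in> dual whole_space"
    using assms(1) bounded_linear_divide[of ?N] bounded_linear_compose[of "\<lambda>x. x / ?N" \<phi>]
    by (simp add: dual_whole_space)
  have "?N \<le> ?N * dual_norm whole_space ?g"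
  proof (rule dual_norm_least[OF subspace_UNIV \<phi>])
    show "\<bar>\<phi> x\<bar> \<le> ?N * dual_norm whole_space ?g" if "x \<in> UNIV \<inter> cball 0 1" for x
      using abs_le_dual_norm[OF subspace_UNIV g that] \<open>0 < ?N\<close> by (simp add: field_simps)
  qed
  moreover have "dual_norm whole_space ?g \<le> 1"
    using abs_le_dual_norm[OF subspace_UNIV \<phi>] \<open>0 < ?N\<close>
    by (intro dual_norm_least[OF subspace_UNIV g]) simp
  ultimately show ?thesis
    using g \<open>0 < ?N\<close> by (simp add: dual_sphere_def)
qed

lemma slice_cball_nonempty:
  assumes "is_slice whole_space (cball 0 1) S"
  shows "S \<noteq> {}"
proof -
  obtain f \<alpha> where f: "f \<in> dual whole_space" "0 < \<alpha>" "S = slice (cball 0 1) f \<alpha>"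
    using assms by (auto simp: is_slice_def dual_sphere_def)
  with bdd_above_ball[OF subspace_UNIV f(1)] show ?thesis
    using slice_nonempty[of "cball 0 1" f \<alpha>] by simp
qed

lemma contains_comb_nonempty:
  assumes "contains_comb (cball 0 1) s W"
  shows "W \<noteq> {}"
proof -
  obtain n :: nat and l S where S: "\<forall>i<n. is_slice whole_space (cball 0 1) (S i)"
    and W: "(\<Sum>i<n. (*\<^sub>R) (l i) ` S i) \<subseteq> W"
    using assms by (rule contains_combE)
  from S have "(\<Sum>i<n. (*\<^sub>R) (l i) ` S i) \<noteq> {}"
  proof (induction n)
    case (Suc n)
    moreover have "S n \<noteq> {}"
      using Suc.prems slice_cball_nonempty by blast
    ultimately show ?case
      by (auto simp: set_plus_def)
  qed simp
  with W show ?thesis by blast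
qed

text \<open>Slices are cut by functionals of norm one, so a nonzero \<phi> is divided by its norm,
  after which the section is itself a slice.\<close>

lemma contains_comb_halfspace:
  fixes \<phi> :: "'a::real_normed_vector \<Rightarrow> real"
  assumes ne: "dual_sphere (whole_space :: 'a nspace) \<noteq> {}"
    and \<phi>: "bounded_linear \<phi>" and x: "x \<in> cball 0 1" "c < \<phi> x"
  shows "contains_comb (cball 0 1) 1 {z \<in> cball 0 1. c < \<phi> z}"
proof -
  let ?N = "dual_norm whole_space \<phi>"
  have dual: "\<phi> \<in> dual whole_space"
    using \<phi> by (simp add: dual_whole_space)
  have "\<exists>S\<subseteq>{z \<in> cball 0 1. c < \<phi> z}. is_slice whole_space (cball 0 1) S"
  proof (cases "?N = 0")
    \<comment> \<open>Here \<phi> vanishes, so \<open>x\<close> forces \<open>c < 0\<close> and the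
      section is the whole ball. Any slice will do, and \<open>ne\<close> supplies one.\<close>
    case True
    then have "\<phi> z = 0" for z
      using abs_le_dual_norm_mult[OF subspace_UNIV dual, of z] by simp
    then have *: "{z \<in> cball 0 1. c < \<phi> z} = cball 0 1"
      using x by auto
    obtain g where "g \<in> dual_sphere (whole_space :: 'a nspace)"
      using ne by blast
    then have "is_slice whole_space (cball 0 1) (slice (cball 0 1) g 1)"
      unfolding is_slice_def by (intro bexI[of _ g] exI[of _ 1]) auto
    then show ?thesis
      unfolding * by (intro exI[of _ "slice (cball 0 1) g 1"]) (auto simp: slice_def)
  next
    case False
    then have "0 < ?N"
      using dual_norm_nonneg[OF subspace_UNIV dual] by simp
    let ?g = "\<lambda>x. \<phi> x / ?N"
    have g: "?g \<in> dual_sphere whole_space"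
      using dual_sphere_normalize[OF \<phi> False] .
    have "c < ?N"
      using abs_le_dual_norm[OF subspace_UNIV dual, of x] x by auto
    \<comment> \<open>The normalized functional has supremum 1 over the ball, so this depth puts the
      cut at \<open>c / ?N\<close>.\<close>
    then have "0 < 1 - c / ?N"
      using \<open>0 < ?N\<close> by simp
    moreover have "slice (cball 0 1) ?g (1 - c / ?N) = {z \<in> cball 0 1. c < \<phi> z}"
      using slice_ball[of UNIV ?g "1 - c / ?N"] g \<open>0 < ?N\<close>
      by (simp add: dual_sphere_def divide_less_cancel)
    ultimately show ?thesis
      using g unfolding is_slice_def by (metis order_refl)
  qed
  then show ?thesis
    using contains_comb_slice contains_comb_mono by blast
qed

section \<open>Bourgain's lemma\<close>

text \<open>The convex hull of \<open>K - ball e r\<close> is compact. It misses \<open>e\<close>,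
  since an extreme point of a hull belongs to the generating set. A hyperplane strictly separating
  \<open>e\<close> from this hull cuts off a part of \<open>K\<close> inside the ball.\<close>

lemma extreme_point_halfspace:
  fixes K :: "'b::euclidean_space set"
  assumes K: "compact K" "convex K" and e: "e extreme_point_of K" and "0 < r"
  obtains a b where "b < a \<bullet> e" "K \<inter> {y. b < a \<bullet> y} \<subseteq> ball e r"
proof -
  let ?H = "convex hull (K - ball e r)"
  have "compact ?H"
    using K(1) by (intro compact_convex_hull compact_diff) auto
  have "?H \<subseteq> K"
    using K(2) by (intro hull_minimal) auto
  have "e \<notin> ?H"
  proof
    assume "e \<in> ?H"
    then have "e extreme_point_of ?H"
      using e \<open>?H \<subseteq> K\<close> by (auto simp: extreme_point_of_def)
    then have "e \<in> K - ball e r"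
      by (rule extreme_point_of_convex_hull)
    then show False
      using \<open>0 < r\<close> by simp
  qed
  then obtain a b where "a \<bullet> e < b" "\<And>y. y \<in> ?H \<Longrightarrow> b < a \<bullet> y"
    using separating_hyperplane_closed_point[of ?H e] \<open>compact ?H\<close> compact_imp_closed
    by (metis convex_convex_hull)
  then show thesis
    using hull_inc[of _ "K - ball e r" convex] by (intro that[of "- b" "- a"]) force+
qed

text \<open>
  The image of the ball in a finite-dimensional space has compact closure, which by Krein-Milman is the
  convex hull of its extreme points; each extreme point has arbitrarily small slices around it.
\<close>

lemma contains_comb_weakly_open:
  fixes T :: "'a::real_normed_vector \<Rightarrow> 'b::euclidean_space"
  assumes ne: "dual_sphere (whole_space :: 'a nspace) \<noteq> {}"
    and T: "bounded_linear T" and U: "open U" and x: "x \<in> cball 0 1" "T x \<in> U"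
  shows "contains_comb (cball 0 1) 1 {z \<in> cball 0 1. T z \<in> U}"
proof -
  interpret T: bounded_linear T by fact
  let ?B = "cball 0 1 :: 'a set"
  let ?K = "closure (T ` ?B)"
  have "bounded (T ` ?B)" "convex (T ` ?B)"
    by (intro bounded_linear_image convex_linear_image T.linear_axioms T bounded_cball convex_cball)+
  then have K: "compact ?K" "convex ?K"
    by (simp_all add: compact_closure convex_closure)
  obtain r where r: "0 < r" "ball (T x) r \<subseteq> U"
    by (rule openE[OF U x(2)])
  have "T x \<in> ?K"
    by (intro subsetD[OF closure_subset] imageI x(1))
  then have "T x \<in> convex hull {e. e extreme_point_of ?K}"
    by (rule subsetD[OF equalityD1[OF Krein_Milman_Minkowski[OF K]]])
  then obtain I u where I: "finite I" "I \<subseteq> {e. e extreme_point_of ?K}"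
    and u: "\<And>e. e \<in> I \<Longrightarrow> 0 \<le> u e" "sum u I = 1" "(\<Sum>e\<in>I. u e *\<^sub>R e) = T x"
    by (auto simp: convex_hull_explicit)
  \<comment> \<open>\<open>T x\<close> is a convex combination of extreme points \<open>e\<close>;
    each is replaced by the part of the ball that \<open>T\<close> sends close to
    \<open>e\<close>.\<close>
  define W where "W e = {z \<in> ?B. T z \<in> ball e r}" for e
  have W: "contains_comb ?B 1 (W e)" if "e \<in> I" for e
  proof -
    have e: "e extreme_point_of ?K"
      using that I(2) by blast
    obtain a b where ab: "b < a \<bullet> e" "?K \<inter> {y. b < a \<bullet> y} \<subseteq> ball e r"
      by (rule extreme_point_halfspace[OF K e r(1)])
    have "e \<in> ?K"
      using e by (simp add: extreme_point_of_def)
    moreover have "open {y. b < a \<bullet> y}"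
      by (simp add: open_halfspace_gt)
    \<comment> \<open>The point \<open>e\<close> lies only in the closure, but an open halfspace
      that meets the closure meets the image itself.\<close>
    ultimately obtain z where "z \<in> ?B" "b < a \<bullet> T z"
      using ab(1) open_Int_closure_eq_empty[of "{y. b < a \<bullet> y}" "T ` ?B"] by fast
    then have "contains_comb ?B 1 {z \<in> ?B. b < a \<bullet> T z}"
      using T bounded_linear_compose[OF bounded_linear_inner_right T]
      by (intro contains_comb_halfspace[OF ne, where x = z]) auto
    moreover have "{z \<in> ?B. b < a \<bullet> T z} \<subseteq> W e"
      using ab(2) closure_subset[of "T ` ?B"] unfolding W_def by blast
    ultimately show ?thesis
      by (rule contains_comb_mono)
  qed
  have "contains_comb ?B 1 (\<Sum>e\<in>I. (*\<^sub>R) (u e) ` W e)"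
    using contains_comb_sum[OF I(1), of u ?B W] u W by simp
  moreover have "(\<Sum>e\<in>I. (*\<^sub>R) (u e) ` W e) \<subseteq> {z \<in> ?B. T z \<in> U}"
  proof
    fix y assume "y \<in> (\<Sum>e\<in>I. (*\<^sub>R) (u e) ` W e)"
    with I(1) obtain w where w: "\<forall>e\<in>I. w e \<in> W e" and y: "y = (\<Sum>e\<in>I. u e *\<^sub>R w e)"
      by (rule set_sum_scaleR_imageE)
    have "y \<in> ?B"
      unfolding y using I(1) u w by (intro convex_sum) (auto simp: W_def)
    moreover have "T y \<in> ball (T x) r"
    proof -
      \<comment> \<open>The error is a convex combination of errors of norm less than
        \<open>r\<close>, so it is again less than \<open>r\<close>.\<close>
      have "T y - T x = (\<Sum>e\<in>I. u e *\<^sub>R (T (w e) - e))"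
        unfolding y using u(3) by (simp add: T.sum T.scaleR scaleR_diff_right sum_subtractf)
      moreover have "(\<Sum>e\<in>I. u e *\<^sub>R (T (w e) - e)) \<in> ball 0 r"
        using I(1) u w by (intro convex_sum) (auto simp: W_def dist_norm norm_minus_commute)
      ultimately have "norm (T y - T x) < r"
        by simp
      then show ?thesis
        by (simp add: dist_norm norm_minus_commute)
    qed
    ultimately show "y \<in> {z \<in> ?B. T z \<in> U}"
      using r(2) by blast
  qed
  ultimately show ?thesis
    by (rule contains_comb_mono)
qed

section \<open>Slices in the quotient\<close>

context real_normed_space
begin

lemma minkowski_comb_bounded:
  assumes "\<And>i. i < n \<Longrightarrow> 0 \<le> l i" "\<And>i. i < n \<Longrightarrow> S i \<subseteq> {x \<in> pts E. vnorm E x \<le> R}"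
    and "u \<in> minkowski_comb E l S n"
  shows "u \<in> pts E \<and> vnorm E u \<le> (\<Sum>i<n. l i) * R"
  using assms
proof (induction n arbitrary: u)
  case 0
  then show ?case
    using zero_closed norm_eq_zero[of "vzero E"] by simp
next
  case (Suc n)
  then obtain v s where u: "u = vadd E v (vscale E (l n) s)"
    and v: "v \<in> minkowski_comb E l S n" and s: "s \<in> S n"
    by auto
  have IH: "v \<in> pts E \<and> vnorm E v \<le> (\<Sum>i<n. l i) * R"
    using Suc.prems v by (intro Suc.IH) auto
  have s': "s \<in> pts E" "vnorm E s \<le> R" "0 \<le> l n"
    using Suc.prems(1,2)[of n] s by auto
  have "vnorm E u \<le> vnorm E v + vnorm E (vscale E (l n) s)"
    unfolding u using IH s' by (intro norm_triangle scale_closed) auto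
  also have "vnorm E (vscale E (l n) s) \<le> l n * R"
    using s' by (simp add: norm_scale mult_left_mono)
  finally show ?case
    using IH s' by (simp add: u add_closed scale_closed algebra_simps)
qed

text \<open>A real supremum bounds its members only if they are bounded above. The bound on
  \<open>C\<close> passes to its slices and to their convex combinations.\<close>

lemma vdist_le_vdiameter:
  assumes C: "C \<subseteq> {x \<in> pts E. vnorm E x \<le> R}" and D: "convex_comb_of_slices E C D"
    and xy: "x \<in> D" "y \<in> D"
  shows "vdist E x y \<le> vdiameter E D"
proof -
  obtain n l S where *: "\<forall>i<n. 0 \<le> l i \<and> is_slice E C (S i)" "(\<Sum>i<n. l i) = 1"
    "D = minkowski_comb E l S n"
    using D unfolding convex_comb_of_slices_def by blast
  have "S i \<subseteq> {x \<in> pts E. vnorm E x \<le> R}" if "i < n" for i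
    using C *(1) that by (auto simp: is_slice_def slice_def)
  then have R: "u \<in> pts E \<and> vnorm E u \<le> R" if "u \<in> D" for u
    using minkowski_comb_bounded[of n l S R u] * that by simp
  have "vdist E u v \<le> R + R" if "u \<in> D" "v \<in> D" for u v
  proof -
    have "vdist E u v \<le> vnorm E u + vnorm E (vscale E (- 1) v)"
      using R that by (simp add: vdist_def norm_triangle scale_closed)
    also have "\<dots> \<le> R + R"
      using R[OF that(1)] R[OF that(2)] by (simp add: norm_scale)
    finally show ?thesis .
  qed
  then have "bdd_above ((\<lambda>(u, v). vdist E u v) ` (D \<times> D))"
    by (intro bdd_aboveI2[where M = "R + R"]) auto
  then show ?thesis
    unfolding vdiameter_def using xy cSUP_upper[of "(x, y)" "D \<times> D"] by fastforce
qed

end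

context
  fixes Y :: "'a::real_normed_vector set"
  assumes Y: "subspace Y" and closed_Y: "closed Y"
begin

lemma quotient_by_simps:
  "pts (quotient_by Y) = range (\<lambda>x. x +o Y)"
  "vzero (quotient_by Y) = 0 +o Y"
  "vadd (quotient_by Y) (x +o Y) (y +o Y) = (x + y) +o Y"
  "vscale (quotient_by Y) c (x +o Y) = (c *\<^sub>R x) +o Y"
  "vnorm (quotient_by Y) (x +o Y) = infdist x Y"
  using Y by (simp_all add: quotient_by_def coset_add coset_scale coset_norm)

lemma vdist_quotient_by: "vdist (quotient_by Y) (x +o Y) (y +o Y) = infdist (x - y) Y"
  by (simp add: vdist_def quotient_by_simps)

lemma coset_in_minkowski_comb:
  assumes "x \<in> (\<Sum>i<n. (*\<^sub>R) (l i) ` W i)" "\<And>i z. i < n \<Longrightarrow> z \<in> W i \<Longrightarrow> z +o Y \<in> S i"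
  shows "x +o Y \<in> minkowski_comb (quotient_by Y) l S n"
  using assms
proof (induction n arbitrary: x)
  case 0
  then show ?case
    by (simp add: quotient_by_simps(2))
next
  case (Suc n)
  then obtain v w where x: "x = v + l n *\<^sub>R w" "w \<in> W n"
    and v: "v \<in> (\<Sum>i<n. (*\<^sub>R) (l i) ` W i)"
    by (auto simp: set_plus_def)
  have "v +o Y \<in> minkowski_comb (quotient_by Y) l S n"
    using Suc.prems(2) v by (intro Suc.IH) auto
  moreover have "x +o Y = vadd (quotient_by Y) (v +o Y) (vscale (quotient_by Y) (l n) (w +o Y))"
    using x by (simp add: quotient_by_simps(3,4))
  moreover have "w +o Y \<in> S n"
    using Suc.prems(2) x by simp
  ultimately show ?case
    unfolding minkowski_comb.simps by blast
qed

lemma dual_quotient_bounded_linear: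
  assumes g: "g \<in> dual (quotient_by Y)"
  shows "bounded_linear (\<lambda>x. g (x +o Y))"
proof -
  obtain K where add: "\<And>x y. g ((x + y) +o Y) = g (x +o Y) + g (y +o Y)"
    and scale: "\<And>c x. g ((c *\<^sub>R x) +o Y) = c * g (x +o Y)"
    and K: "\<And>x. \<bar>g (x +o Y)\<bar> \<le> K * infdist x Y"
    using g unfolding dual_def by (simp add: quotient_by_simps) metis
  have "\<bar>g (x +o Y)\<bar> \<le> norm x * \<bar>K\<bar>" for x
  proof -
    have "K * infdist x Y \<le> \<bar>K\<bar> * norm x"
      using infdist_le_norm[OF Y] by (intro mult_mono) (auto simp: infdist_nonneg)
    with K[of x] show ?thesis
      by (simp add: mult.commute)
  qed
  then show ?thesis
    by (intro bounded_linear_intro) (auto simp: add scale)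
qed

text \<open>If a ball around \<open>x\<close> misses \<open>Z\<close>, the quotient ball of the same
  radius misses the image. A coset \<open>z +o Y\<close> in it would have a representative
  \<open>z + y\<close> in the ball around \<open>x\<close>, and by invariance this lies in
  \<open>Z\<close>.\<close>

lemma vclosed_coset_image:
  assumes Z: "closed Z" and inv: "\<And>z y. \<lbrakk>z \<in> Z; y \<in> Y\<rbrakk> \<Longrightarrow> z + y \<in> Z"
  shows "vclosed (quotient_by Y) ((\<lambda>x. x +o Y) ` Z)"
proof -
  interpret Metric_space "pts (quotient_by Y)" "vdist (quotient_by Y)"
    using real_normed_space_quotient_by[OF Y closed_Y] by (rule real_normed_space.Metric_space_vdist)
  let ?q = "\<lambda>x. x +o Y"
  have "\<exists>r>0. disjnt (?q ` Z) (mball (?q x) r)" if "?q x \<notin> ?q ` Z" for x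
  proof -
    have "x \<in> - Z"
      using that by blast
    then obtain r where r: "0 < r" "ball x r \<subseteq> - Z"
      using Z by (meson open_Compl openE)
    have "z +o Y \<notin> mball (x +o Y) r" if "z \<in> Z" for z
    proof
      assume "z +o Y \<in> mball (x +o Y) r"
      then have "infdist (x - z) Y < r"
        by (simp add: vdist_quotient_by)
      then obtain y where "y \<in> Y" "dist (x - z) y < r"
        using infdist_lessE[OF Y] by blast
      then have "z + y \<in> ball x r"
        by (simp add: dist_norm algebra_simps)
      with r inv[OF \<open>z \<in> Z\<close> \<open>y \<in> Y\<close>] show False
        by blast
    qed
    then have "disjnt (?q ` Z) (mball (?q x) r)"
      unfolding disjnt_iff by blast
    with r show ?thesis
      by blast
  qed
  then show ?thesis
    unfolding vclosed_def closedin_metric by (auto simp: quotient_by_simps(1))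
qed

text \<open>A small combination of slices in the quotient is pulled back slice by slice. Each slice
  pulls back to a nonempty halfspace section of \<open>A\<close>, to which \<open>comb\<close>
  applies, and distances modulo \<open>Y\<close> are those of the cosets.\<close>

lemma strongly_regular_lift:
  assumes sr: "strongly_regular (quotient_by Y)"
    and A: "A \<noteq> {}" "convex A" "\<And>a. a \<in> A \<Longrightarrow> norm a \<le> R"
    and comb: "\<And>(G :: 'a \<Rightarrow> real) c a. \<lbrakk>bounded_linear G; a \<in> A; c < G a\<rbrakk> \<Longrightarrow> contains_comb C 1 {z \<in> A. c < G z}"
    and "0 < \<epsilon>"
  obtains D where "contains_comb C 1 D" "D \<subseteq> A"
    "\<forall>x\<in>D. \<forall>y\<in>D. infdist (x - y) Y < \<epsilon>"
proof -
  let ?Q = "quotient_by Y" and ?q = "\<lambda>x. x +o Y"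
  interpret Q: real_normed_space ?Q
    using Y closed_Y by (rule real_normed_space_quotient_by)
  \<comment> \<open>Adding \<open>Y\<close> before closing makes \<open>Z\<close> invariant under
    \<open>Y\<close>, so that its image is closed in the quotient.\<close>
  define Z where "Z = closure (A + Y)"
  have A_Z: "a \<in> Z" if "a \<in> A" for a
    using that subspace_0[OF Y] closure_subset[of "A + Y"] set_plus_intro[of a A 0 Y]
    by (auto simp: Z_def)
  have "convex Z"
    unfolding Z_def using A(2) subspace_imp_convex[OF Y]
    by (intro convex_closure convex_set_plus)
  have inv: "z + y \<in> Z" if "z \<in> Z" "y \<in> Y" for z y
  proof -
    have "(+) y ` (A + Y) \<subseteq> A + Y"
    proof
      fix w assume "w \<in> (+) y ` (A + Y)"
      then obtain a y' where "a \<in> A" "y' \<in> Y" "w = a + (y' + y)"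
        by (auto simp: set_plus_def add_ac)
      then show "w \<in> A + Y"
        using \<open>y \<in> Y\<close> subspace_add[OF Y] by blast
    qed
    then have "(+) y ` Z \<subseteq> Z"
      unfolding Z_def closure_translation[symmetric] by (rule closure_mono)
    with that(1) show ?thesis
      by (auto simp: add.commute)
  qed
  have bound: "infdist z Y \<le> R" if "z \<in> Z" for z
  proof -
    have "A + Y \<subseteq> {x. infdist x Y \<le> R}"
    proof
      fix x assume "x \<in> A + Y"
      then obtain a y where "a \<in> A" "y \<in> Y" "x = a + y"
        by (auto simp: set_plus_def)
      then show "x \<in> {x. infdist x Y \<le> R}"
        using infdist_add_subspace[OF Y closed_Y, of a y] infdist_le_norm[OF Y, of a] A(3)[of a]
        by simp
    qed
    moreover have "closed {x. infdist x Y \<le> R}"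
      by (intro closed_Collect_le continuous_intros)
    ultimately show ?thesis
      using that closure_minimal[of "A + Y" "{x. infdist x Y \<le> R}"] by (auto simp: Z_def)
  qed
  have "vconvex ?Q (?q ` Z)"
    unfolding vconvex_def using \<open>convex Z\<close>
    by (auto simp: quotient_by_simps(3,4) intro!: imageI convexD)
  moreover have "?q ` Z \<subseteq> {c \<in> pts ?Q. vnorm ?Q c \<le> R}"
    using bound by (auto simp: quotient_by_simps(1,5))
  then have sub: "?q ` Z \<subseteq> pts ?Q" and "vbounded ?Q (?q ` Z)"
    and ball: "?q ` Z \<subseteq> {c \<in> pts ?Q. vnorm ?Q c \<le> R}"
    by (auto simp: vbounded_def)
  moreover have "vclosed ?Q (?q ` Z)"
    using inv by (intro vclosed_coset_image) (auto simp: Z_def)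
  moreover have "?q ` Z \<noteq> {}"
    using A(1) A_Z by blast
  ultimately obtain D0 where D0: "convex_comb_of_slices ?Q (?q ` Z) D0" "vdiameter ?Q D0 < \<epsilon>"
    using sr \<open>0 < \<epsilon>\<close> unfolding strongly_regular_def by meson
  obtain n l S where l: "\<forall>i<n. 0 \<le> l i \<and> is_slice ?Q (?q ` Z) (S i)" "(\<Sum>i<n. l i) = 1"
    and D0_eq: "D0 = minkowski_comb ?Q l S n"
    using D0(1) unfolding convex_comb_of_slices_def by blast
  define W where "W i = {a \<in> A. ?q a \<in> S i}" for i
  have W: "contains_comb C 1 (W i)" if "i < n" for i
  proof -
    have "is_slice ?Q (?q ` Z) (S i)"
      using l(1) that by blast
    then obtain g \<alpha> where g: "g \<in> dual ?Q" and "0 < \<alpha>" and S: "S i = slice (?q ` Z) g \<alpha>"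
      unfolding is_slice_def dual_sphere_def by blast
    define s where "s = (SUP z\<in>?q ` Z. g z)"
    let ?G = "\<lambda>x. g (?q x)"
    have G: "bounded_linear ?G"
      using g by (rule dual_quotient_bounded_linear)
    interpret G: bounded_linear ?G by fact
    obtain K where K: "\<And>c. c \<in> pts ?Q \<Longrightarrow> \<bar>g c\<bar> \<le> K * vnorm ?Q c"
      using g unfolding dual_def by blast
    have G_Y: "?G y = 0" if "y \<in> Y" for y
      using K[of "?q y"] that by (simp add: quotient_by_simps(1,5))
    have "?G z \<le> \<bar>K\<bar> * R" if "z \<in> Z" for z
    proof -
      have "\<bar>?G z\<bar> \<le> K * infdist z Y"
        using K[of "?q z"] by (simp add: quotient_by_simps(1,5))
      also have "\<dots> \<le> \<bar>K\<bar> * R"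
        using bound[OF that] by (intro mult_mono) (auto simp: infdist_nonneg)
      finally show ?thesis by simp
    qed
    then have "bdd_above (g ` ?q ` Z)"
      by (auto intro!: bdd_aboveI2)
    then have "slice (?q ` Z) g \<alpha> \<noteq> {}"
      using A(1) A_Z \<open>0 < \<alpha>\<close> by (intro slice_nonempty) auto
    then obtain z where "z \<in> Z" "s - \<alpha> < ?G z"
      by (auto simp: slice_def s_def)
    moreover have "open {x. s - \<alpha> < ?G x}"
      by (intro open_Collect_less continuous_intros G.continuous_on)
    \<comment> \<open>The slice is only known to meet the image of the closure. Openness moves the
      point into \<open>A + Y\<close>, and since \<open>?G\<close> vanishes on \<open>Y\<close> its
      component in \<open>A\<close> has the same value.\<close>
    ultimately obtain x where "x \<in> A + Y" "s - \<alpha> < ?G x"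
      using open_Int_closure_eq_empty[of "{x. s - \<alpha> < ?G x}" "A + Y"] unfolding Z_def by fast
    then obtain a where "a \<in> A" "s - \<alpha> < ?G a"
      using G_Y G.add by (auto simp: set_plus_def)
    then have "contains_comb C 1 {z \<in> A. s - \<alpha> < ?G z}"
      using comb[OF G] by blast
    moreover have "{z \<in> A. s - \<alpha> < ?G z} = W i"
      using A_Z by (auto simp: W_def S slice_def s_def)
    ultimately show ?thesis
      by simp
  qed
  let ?D = "\<Sum>i<n. (*\<^sub>R) (l i) ` W i"
  show thesis
  proof
    show "contains_comb C 1 ?D"
      using contains_comb_sum[of "{..<n}" l C W] l W by simp
    show "?D \<subseteq> A"
      using A(2) l by (intro sum_scaleR_image_subset_convex) (auto simp: W_def)
    have "infdist (x - y) Y < \<epsilon>" if "x \<in> ?D" "y \<in> ?D" for x y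
    proof -
      have "?q x \<in> D0" "?q y \<in> D0"
        unfolding D0_eq using that by (auto intro!: coset_in_minkowski_comb simp: W_def)
      from Q.vdist_le_vdiameter[OF ball D0(1) this] show ?thesis
        using D0(2) by (simp add: vdist_quotient_by)
    qed
    then show "\<forall>x\<in>?D. \<forall>y\<in>?D. infdist (x - y) Y < \<epsilon>"
      by blast
  qed
qed

end

section \<open>Combinations of slices close to the subspace\<close>

lemma contains_comb_convex_sum:
  assumes "contains_comb C 1 V" "contains_comb C 1 W" "0 \<le> u" "0 \<le> v" "u + v = 1"
  shows "contains_comb C 1 ((*\<^sub>R) u ` V + (*\<^sub>R) v ` W)"
  using contains_comb_add[OF contains_comb_scale[OF assms(1,3)] contains_comb_scale[OF assms(2,4)]]
    assms(5) by simp

lemma contains_comb_near_subspace: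
  fixes Y :: "'a::real_normed_vector set" and f :: "'a \<Rightarrow> real"
  assumes Y: "subspace Y" "closed Y" and sr: "strongly_regular (quotient_by Y)"
    and ne: "dual_sphere (whole_space :: 'a nspace) \<noteq> {}"
    and f: "bounded_linear f" and y0: "y0 \<in> Y" "y0 \<in> cball 0 1" "c < f y0" and "0 < \<delta>"
  shows "contains_comb (cball 0 1) 1 {x \<in> cball 0 1. c < f x \<and> infdist x Y < \<delta>}"
proof (rule ccontr)
  assume not: "\<not> ?thesis"
  let ?B = "cball 0 1 :: 'a set"
  define A where "A = {x \<in> ?B. c < f x}"
  interpret f: bounded_linear f by fact
  have "convex (f -` {c<..})"
    by (intro convex_linear_vimage f.linear_axioms convex_real_interval)
  moreover have "A = ?B \<inter> f -` {c<..}"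
    by (auto simp: A_def)
  ultimately have "convex A"
    by (simp add: convex_Int)
  \<comment> \<open>Half of \<delta> is reserved for the diameter modulo \<open>Y\<close>, the other
    half for the distance of one point from \<open>Y\<close>.\<close>
  define small where "small D \<longleftrightarrow> contains_comb ?B 1 D \<and> D \<subseteq> A \<and>
    (\<forall>x\<in>D. \<forall>y\<in>D. infdist (x - y) Y < \<delta> / 2)" for D
  define U where "U = \<Union>{D. small D}"
  have "convex U"
  proof (rule convexI)
    fix x y and u v :: real
    assume uv: "0 \<le> u" "0 \<le> v" "u + v = 1" and "x \<in> U" "y \<in> U"
    then obtain D E where D: "small D" "x \<in> D" and E: "small E" "y \<in> E"
      unfolding U_def by blast
    let ?S = "(*\<^sub>R) u ` D + (*\<^sub>R) v ` E"
    have "?S \<subseteq> A"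
    proof
      fix z assume "z \<in> ?S"
      then obtain a b where "a \<in> D" "b \<in> E" "z = u *\<^sub>R a + v *\<^sub>R b"
        by (auto simp: set_plus_def)
      then show "z \<in> A"
        using \<open>convex A\<close> uv D(1) E(1) unfolding small_def by (metis convexD subsetD)
    qed
    moreover have "infdist (z - z') Y < \<delta> / 2" if zz: "z \<in> ?S" "z' \<in> ?S" for z z'
    proof -
      obtain a b where ab: "a \<in> D" "b \<in> E" "z = u *\<^sub>R a + v *\<^sub>R b"
        using zz(1) by (auto simp: set_plus_def)
      obtain a' b' where ab': "a' \<in> D" "b' \<in> E" "z' = u *\<^sub>R a' + v *\<^sub>R b'"
        using zz(2) by (auto simp: set_plus_def)
      have "z - z' = u *\<^sub>R (a - a') + v *\<^sub>R (b - b')"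
        by (simp add: ab ab' algebra_simps)
      then have "infdist (z - z') Y \<le> u * infdist (a - a') Y + v * infdist (b - b') Y"
        using infdist_add_subspace[OF Y, of "u *\<^sub>R (a - a')" "v *\<^sub>R (b - b')"] uv
        by (simp add: infdist_scaleR_subspace[OF Y])
      also have "\<dots> < \<delta> / 2"
        using D(1) E(1) ab ab' uv unfolding small_def by (intro convex_bound_lt) auto
      finally show ?thesis .
    qed
    moreover have "contains_comb ?B 1 ?S"
      using D(1) E(1) uv unfolding small_def by (intro contains_comb_convex_sum) auto
    ultimately have "small ?S"
      unfolding small_def by blast
    then show "u *\<^sub>R x + v *\<^sub>R y \<in> U"
      unfolding U_def using D(2) E(2) by blast
  qed
  \<comment> \<open>A small set with one point closer than half of \<delta> to \<open>Y\<close> lies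
    entirely within \<delta> of it, which \<open>not\<close> forbids.\<close>
  have far: "\<delta> / 2 \<le> infdist x Y" if "x \<in> U" for x
  proof (rule ccontr)
    assume x: "\<not> \<delta> / 2 \<le> infdist x Y"
    obtain D where D: "small D" "x \<in> D"
      using \<open>x \<in> U\<close> unfolding U_def by blast
    have "infdist z Y < \<delta>" if "z \<in> D" for z
    proof -
      have "infdist (z - x) Y < \<delta> / 2"
        using D that unfolding small_def by blast
      then show ?thesis
        using infdist_add_subspace[OF Y, of x "z - x"] x by simp
    qed
    then have "D \<subseteq> {x \<in> ?B. c < f x \<and> infdist x Y < \<delta>}"
      using D(1) unfolding small_def A_def by blast
    then show False
      using not D(1) contains_comb_mono unfolding small_def by blast
  qed
  obtain h where h: "bounded_linear h" "\<And>x. \<bar>h x\<bar> \<le> norm x" "\<And>y. y \<in> Y \<Longrightarrow> h y = 0"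
    and h_U: "\<And>x. x \<in> U \<Longrightarrow> \<delta> / 2 \<le> h x"
  proof (cases "U = {}")
    \<comment> \<open>With \<open>U\<close> empty, the zero functional serves: the final step then
      contradicts the emptiness of \<open>U\<close>.\<close>
    case True
    then show thesis
      by (intro that[of "\<lambda>_. 0"]) (auto simp: bounded_linear_zero)
  next
    case False
    then show thesis
      using separate_convex_from_subspace[OF Y \<open>convex U\<close> False far] that by blast
  qed
  define A' where "A' = {x \<in> ?B. c < f x \<and> h x < \<delta> / 2}"
  \<comment> \<open>Since \<open>h\<close> vanishes on \<open>Y\<close>, the extra constraint on
    \<open>h\<close> cannot exclude \<open>y0\<close>.\<close>
  have "y0 \<in> A'"
    using y0 h(3)[of y0] \<open>0 < \<delta>\<close> by (simp add: A'_def)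
  have "convex A'"
  proof -
    have "convex (h -` {..<\<delta> / 2})"
      by (intro convex_linear_vimage bounded_linear.linear h(1) convex_real_interval)
    moreover have "A' = A \<inter> h -` {..<\<delta> / 2}"
      by (auto simp: A_def A'_def)
    ultimately show ?thesis
      using \<open>convex A\<close> by (simp add: convex_Int)
  qed
  have comb: "contains_comb ?B 1 {z \<in> A'. d < G z}"
    if G: "bounded_linear G" and a: "a \<in> A'" "d < G a" for G :: "'a \<Rightarrow> real" and d a
  proof -
    \<comment> \<open>The three strict inequalities are one open condition on a map into a
      three-dimensional space, so Bourgain's lemma applies.\<close>
    let ?T = "\<lambda>x. (f x, h x, G x)" and ?O = "{c<..} \<times> {..<\<delta> / 2} \<times> {d<..}"
    have "contains_comb ?B 1 {z \<in> ?B. ?T z \<in> ?O}"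
    proof (rule contains_comb_weakly_open[OF ne])
      show "bounded_linear ?T"
        by (intro bounded_linear_Pair f h(1) G)
      show "open ?O"
        by (intro open_Times) auto
      show "a \<in> ?B" "?T a \<in> ?O"
        using a by (auto simp: A'_def)
    qed
    moreover have "{z \<in> ?B. ?T z \<in> ?O} = {z \<in> A'. d < G z}"
      by (auto simp: A'_def)
    ultimately show ?thesis by simp
  qed
  obtain D where D: "contains_comb ?B 1 D" "D \<subseteq> A'"
    "\<forall>x\<in>D. \<forall>y\<in>D. infdist (x - y) Y < \<delta> / 2"
  proof (rule strongly_regular_lift[OF Y sr _ \<open>convex A'\<close>])
    show "A' \<noteq> {}"
      using \<open>y0 \<in> A'\<close> by blast
    show "contains_comb ?B 1 {z \<in> A'. d < G z}"
      if "bounded_linear G" "a \<in> A'" "d < G a" for G :: "'a \<Rightarrow> real" and d a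
      using comb that .
    show "norm a \<le> 1" if "a \<in> A'" for a
      using that by (simp add: A'_def)
    show "0 < \<delta> / 2"
      using \<open>0 < \<delta>\<close> by simp
  qed (use that in blast)
  obtain d where "d \<in> D"
    using contains_comb_nonempty[OF D(1)] by blast
  \<comment> \<open>As \<open>A'\<close> is contained in \<open>A\<close>, the set \<open>D\<close>
    is among those making up \<open>U\<close>, where \<open>h\<close> is at least half of \<delta>;
    on \<open>A'\<close> it is smaller.\<close>
  have "small D"
    using D unfolding small_def A_def A'_def by blast
  then have "\<delta> / 2 \<le> h d"
    using h_U \<open>d \<in> D\<close> unfolding U_def by blast
  then show False
    using D(2) \<open>d \<in> D\<close> by (auto simp: A'_def)
qed

section \<open>From the ball of the subspace to the ball of the whole space\<close>

text \<open>Domination by the norm gives dual norm at most 1. The ball of \<open>Y\<close> lies in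
  the full ball, so the norm cannot drop below that of \<open>f\<close>.\<close>

lemma dual_sphere_extend:
  fixes Y :: "'a::real_normed_vector set"
  assumes Y: "subspace Y" and f: "f \<in> dual_sphere (subspace_of Y)"
  obtains F where "F \<in> dual_sphere (whole_space :: 'a nspace)" "bounded_linear F"
    "\<And>x. \<bar>F x\<bar> \<le> norm x" "\<And>y. y \<in> Y \<Longrightarrow> F y = f y"
proof -
  have f: "f \<in> dual (subspace_of Y)" and f1: "dual_norm (subspace_of Y) f = 1"
    using assms by (auto simp: dual_sphere_def)
  obtain F where F: "bounded_linear F" "\<And>x. \<bar>F x\<bar> \<le> norm x" "\<And>y. y \<in> Y \<Longrightarrow> F y = f y"
    using Hahn_Banach_extension[of Y f] Y dual_subspace_add[OF Y f] dual_subspace_scale[OF Y f]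
      abs_le_dual_norm_mult[OF Y f] f1 by (metis mult_1)
  then have dual: "F \<in> dual whole_space"
    by (simp add: dual_whole_space)
  have "dual_norm whole_space F \<le> 1"
    using F(2) by (intro dual_norm_least[OF subspace_UNIV dual]) (auto intro: order_trans)
  moreover have "dual_norm (subspace_of Y) f \<le> dual_norm whole_space F"
    using abs_le_dual_norm[OF subspace_UNIV dual] F(3)
    by (intro dual_norm_least[OF Y f]) fastforce
  ultimately have "F \<in> dual_sphere whole_space"
    using dual f1 by (simp add: dual_sphere_def)
  with that F show thesis by blast
qed

text \<open>A point \<open>y\<close> of \<open>Y\<close> within \<delta> of \<open>x\<close> has
  norm at most 1 + \<delta>. Rescaling it into the ball moves it by at most another \<delta>, and
  the margin 2 \<delta> in the value of \<open>F\<close> absorbs the total displacement.\<close>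

lemma slice_approx:
  fixes Y :: "'a::real_normed_vector set"
  assumes Y: "subspace Y" and F: "bounded_linear F" "\<And>x. \<bar>F x\<bar> \<le> norm x"
    and x: "x \<in> cball 0 1" "c + 2 * \<delta> < F x" "infdist x Y < \<delta>"
  obtains z where "z \<in> Y \<inter> cball 0 1" "c < F z" "norm (x - z) < 2 * \<delta>"
proof -
  interpret F: bounded_linear F by fact
  obtain y where y: "y \<in> Y" "norm (x - y) < \<delta>"
    using infdist_lessE[OF Y x(3)] by (auto simp: dist_norm)
  have "0 < \<delta>"
    using y(2) norm_ge_zero le_less_trans by blast
  define z where "z = y /\<^sub>R (1 + \<delta>)"
  have ny: "norm y \<le> 1 + \<delta>"
    using x(1) y(2) norm_triangle_sub[of y x] by (simp add: norm_minus_commute)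
  have "z \<in> Y \<inter> cball 0 1"
    using y(1) Y ny \<open>0 < \<delta>\<close> by (simp add: z_def subspace_scale field_simps)
  moreover have xz: "norm (x - z) < 2 * \<delta>"
  proof -
    have "y = (1 + \<delta>) *\<^sub>R z"
      using \<open>0 < \<delta>\<close> by (simp add: z_def)
    then have "y - z = \<delta> *\<^sub>R z"
      by (simp add: scaleR_left_distrib)
    moreover have "norm z \<le> 1"
      using calculation \<open>z \<in> Y \<inter> cball 0 1\<close> by simp
    ultimately have "norm (y - z) \<le> \<delta>"
      using \<open>0 < \<delta>\<close> by (simp add: mult_left_le)
    then show ?thesis
      using y(2) norm_triangle_ineq[of "x - y" "y - z"] by simp
  qed
  moreover have "c < F z"
    using F(2)[of "x - z"] xz x(2) by (simp add: F.diff)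
  ultimately show thesis
    using that by blast
qed

theorem proposition4p2:
  fixes Y :: "'a::banach set"
  assumes "subspace Y" and "closed Y"
    and "strongly_regular (quotient_by Y)"
    and "BSCSP (subspace_of Y)"
  shows "BSCSP (subspace_of (UNIV :: 'a set))"
  unfolding BSCSP_def unit_ball_whole_space
proof (intro allI impI)
  fix \<epsilon> :: real assume "0 < \<epsilon>"
  note Y = assms(1)
  interpret Y: real_normed_space "subspace_of Y"
    using Y by (rule real_normed_space_subspace_of)
  let ?B = "cball 0 1 :: 'a set"
  let ?BY = "Y \<inter> ?B"
  obtain D0 where D0: "convex_comb_of_slices (subspace_of Y) ?BY D0"
    "vdiameter (subspace_of Y) D0 < \<epsilon> / 2"
    using assms(4) \<open>0 < \<epsilon>\<close> unfolding BSCSP_def unit_ball_subspace_of by (meson half_gt_zero)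
  obtain n :: nat and l S where l: "\<forall>i<n. 0 \<le> l i \<and> is_slice (subspace_of Y) ?BY (S i)" "(\<Sum>i<n. l i) = 1"
    and D0_eq: "D0 = (\<Sum>i<n. (*\<^sub>R) (l i) ` S i)"
    using D0(1) unfolding convex_comb_of_slices_def minkowski_comb_subspace_of by blast
  have "\<exists>W. contains_comb ?B 1 W \<and> (\<forall>w\<in>W. \<exists>z\<in>S i. norm (w - z) \<le> \<epsilon> / 16)" if "i < n" for i
  proof -
    have "is_slice (subspace_of Y) ?BY (S i)"
      using l(1) that by blast
    then obtain f \<alpha> where f: "f \<in> dual_sphere (subspace_of Y)" and \<alpha>: "0 < \<alpha>" "S i = slice ?BY f \<alpha>"
      unfolding is_slice_def by blast
    obtain F where F: "F \<in> dual_sphere (whole_space :: 'a nspace)" "bounded_linear F"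
      "\<And>x. \<bar>F x\<bar> \<le> norm x" "\<And>y. y \<in> Y \<Longrightarrow> F y = f y"
      using dual_sphere_extend[OF Y f] by blast
    have f': "f \<in> dual (subspace_of Y)" "dual_norm (subspace_of Y) f = 1"
      using f by (auto simp: dual_sphere_def)
    have S: "S i = {z \<in> ?BY. 1 - \<alpha> < F z}"
      using F(4) f'(2) by (auto simp: \<alpha>(2) slice_ball[OF Y f'(1)])
    \<comment> \<open>The margin 2 \<delta> must stay below \<alpha>, so that the narrower slice is
      nonempty, and within \<epsilon> / 16, the error allowed per slice.\<close>
    define \<delta> where "\<delta> = min (\<alpha> / 4) (\<epsilon> / 32)"
    have \<delta>: "0 < \<delta>" "2 * \<delta> < \<alpha>" "2 * \<delta> \<le> \<epsilon> / 16"
      using \<alpha>(1) \<open>0 < \<epsilon>\<close> by (auto simp: \<delta>_def)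
    have "slice ?BY f (\<alpha> - 2 * \<delta>) \<noteq> {}"
      using \<delta>(2) subspace_0[OF Y] bdd_above_ball[OF Y f'(1)] by (intro slice_nonempty) auto
    then obtain y0 where y0: "y0 \<in> Y" "y0 \<in> ?B" "1 - \<alpha> + 2 * \<delta> < F y0"
      using F(4) f'(2) by (auto simp: slice_ball[OF Y f'(1)])
    let ?W = "{x \<in> ?B. 1 - \<alpha> + 2 * \<delta> < F x \<and> infdist x Y < \<delta>}"
    \<comment> \<open>\<open>F\<close> itself witnesses that the dual sphere of the whole space is
      nonempty.\<close>
    have "contains_comb ?B 1 ?W"
      using F(1) by (intro contains_comb_near_subspace[OF assms(1-3) _ F(2) y0 \<delta>(1)]) blast
    moreover have "\<exists>z\<in>S i. norm (w - z) \<le> \<epsilon> / 16" if "w \<in> ?W" for w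
    proof -
      have "w \<in> ?B" "1 - \<alpha> + 2 * \<delta> < F w" "infdist w Y < \<delta>"
        using that by auto
      then obtain z where "z \<in> ?BY" "1 - \<alpha> < F z" "norm (w - z) < 2 * \<delta>"
        by (rule slice_approx[OF Y F(2,3)])
      then show ?thesis
        using \<delta>(3) unfolding S by (intro bexI[of _ z]) auto
    qed
    ultimately show ?thesis
      by blast
  qed
  then obtain W where W: "\<And>i. i < n \<Longrightarrow> contains_comb ?B 1 (W i)"
    and near: "\<And>i w. \<lbrakk>i < n; w \<in> W i\<rbrakk> \<Longrightarrow> \<exists>z\<in>S i. norm (w - z) \<le> \<epsilon> / 16"
    by metis
  have "contains_comb ?B 1 (\<Sum>i<n. (*\<^sub>R) (l i) ` W i)"
    using contains_comb_sum[of "{..<n}" l ?B W] l W by simp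
  then obtain D where D: "D \<subseteq> (\<Sum>i<n. (*\<^sub>R) (l i) ` W i)" "convex_comb_of_slices whole_space ?B D"
    unfolding contains_comb_iff by blast
  have approx: "\<exists>z\<in>D0. norm (x - z) \<le> \<epsilon> / 16" if "x \<in> D" for x
  proof -
    have "x \<in> (\<Sum>i<n. (*\<^sub>R) (l i) ` W i)"
      using D(1) that by blast
    then obtain w where w: "\<forall>i\<in>{..<n}. w i \<in> W i" and x: "x = (\<Sum>i<n. l i *\<^sub>R w i)"
      by (rule set_sum_scaleR_imageE[OF finite_lessThan])
    then have "\<forall>i\<in>{..<n}. \<exists>z\<in>S i. norm (w i - z) \<le> \<epsilon> / 16"
      using near by blast
    then obtain z where z: "\<And>i. i < n \<Longrightarrow> z i \<in> S i \<and> norm (w i - z i) \<le> \<epsilon> / 16"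
      by (metis lessThan_iff)
    let ?z = "\<Sum>i<n. l i *\<^sub>R z i"
    have "?z \<in> D0"
      unfolding D0_eq using z by (auto simp: set_sum_alt)
    moreover have "x - ?z = (\<Sum>i<n. l i *\<^sub>R (w i - z i))"
      unfolding x by (simp add: scaleR_diff_right sum_subtractf)
    \<comment> \<open>Averaging with the same weights does not increase the error.\<close>
    moreover have "(\<Sum>i<n. l i *\<^sub>R (w i - z i)) \<in> cball 0 (\<epsilon> / 16)"
      using l z by (intro convex_sum) auto
    ultimately show ?thesis
      by (intro bexI[of _ ?z]) auto
  qed
  have D0_dist: "norm (z - z') < \<epsilon> / 2" if "z \<in> D0" "z' \<in> D0" for z z'
  proof -
    have "?BY \<subseteq> {x \<in> pts (subspace_of Y). vnorm (subspace_of Y) x \<le> 1}"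
      by (auto simp: subspace_of_def)
    from Y.vdist_le_vdiameter[OF this D0(1) that] D0(2)
    have "vdist (subspace_of Y) z z' < \<epsilon> / 2"
      by linarith
    \<comment> \<open>\<open>vdist\<close> is the norm distance only on the carrier
      \<open>Y\<close>; outside it has the default value 0.\<close>
    moreover have "D0 \<subseteq> Y"
      unfolding D0_eq using l Y
      by (intro sum_scaleR_image_subset_convex subspace_imp_convex) (auto simp: is_slice_def slice_def)
    ultimately show ?thesis
      using that by (auto simp: vdist_def subspace_of_def subset_iff)
  qed
  \<comment> \<open>Two errors of \<epsilon> / 16 and the bound \<epsilon> / 2 add up to 5 / 8 of
    \<epsilon>. A weak bound strictly below \<epsilon> survives the passage to the supremum.\<close>
  have "norm (x - x') \<le> 3 / 4 * \<epsilon>" if xx: "x \<in> D" "x' \<in> D" for x x'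
  proof -
    obtain z z' where z: "z \<in> D0" "norm (x - z) \<le> \<epsilon> / 16" and z': "z' \<in> D0" "norm (x' - z') \<le> \<epsilon> / 16"
      using approx xx by meson
    have eq: "x - x' = ((x - z) + (z - z')) - (x' - z')"
      by simp
    have "norm (x - x') \<le> norm ((x - z) + (z - z')) + norm (x' - z')"
      unfolding eq by (rule norm_triangle_ineq4)
    also have "norm ((x - z) + (z - z')) \<le> norm (x - z) + norm (z - z')"
      by (rule norm_triangle_ineq)
    finally show ?thesis
      using z z' D0_dist[OF z(1) z'(1)] \<open>0 < \<epsilon>\<close> by simp
  qed
  moreover have "D \<noteq> {}"
    using contains_comb_nonempty D(2) contains_comb_iff by blast
  ultimately have "vdiameter whole_space D \<le> 3 / 4 * \<epsilon>"
    unfolding vdiameter_def by (intro cSUP_least) (auto simp: vdist_def subspace_of_def)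
  then have "vdiameter whole_space D < \<epsilon>"
    using \<open>0 < \<epsilon>\<close> by simp
  with D(2) show "\<exists>D. convex_comb_of_slices whole_space ?B D \<and> vdiameter whole_space D < \<epsilon>"
    by blast
qed

end
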